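(* Let $s,m\in\mathbb{N}$ and let $p\in\mathbb{Z}_2[x]$ be an irreducible polynomial of degree $m$. Let $\boldsymbol{\sigma}_1,\dots,\boldsymbol{\sigma}_{2^m}\in\mathbb{Q}_{2^m}^s$ be independent and uniformly distributed. Define the multiset (union with multiplicities) $$Q:=\bigcup_{r=0}^{2^m-1}\bigl(P_p(r)\oplus\boldsymbol{\sigma}_{r+1}\bigr),$$ where $r\in\{0,\ldots,2^m-1\}$ is identified with a polynomial in $G_m$, and write $N:=|Q|=2^{2m}$. Then, for every $\delta\in(0,1)$, with probability at least $\delta$, the star discrepancy of $Q\subseteq\mathbb{Q}_{2^m}^s$ satisfies $$D_N^\ast(Q)\le C_0\,\frac{s(\log(2N)+1)+\log 2-\log(1-\delta)}{N^{1/2}},\qquad C_0:=\frac13\left(1+\sqrt{1+\frac{18}{\log 3}}\right)=1.723\ldots,$$ where $\log$ is the natural logarithm.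
   Context: Star discrepancy: for a finite multiset $P=\{\bm{x}_0,\dots,\bm{x}_{N-1}\}$ in $[0,1)^s$ (points counted with multiplicity), $D_N^*(P):=\sup_{\bm z\in[0,1]^s}\left|\frac1N\sum_{n=0}^{N-1}\mathbf 1_{[\bm 0,\bm z)}(\bm x_n)-\lambda([\bm 0,\bm z))\right|$, where $\mathbf 1_{[\bm 0,\bm z)}$ is the indicator function of $[\bm 0,\bm z)=\prod_{j=1}^s[0,z_j)$ and $\lambda$ is Lebesgue measure. $\mathbb{Z}_2=\{0,1\}$ is the field with two elements, with addition denoted $\oplus$; $G_m:=\{q\in\mathbb{Z}_2[x]:\deg(q)<m\}$ (including $0$); $\mathbb{Q}_{2^m}:=\{0,\frac1{2^m},\ldots,\frac{2^m-1}{2^m}\}$. An integer $n=\sum_{i=0}^{m-1}n_i2^i\in\{0,\dots,2^m-1\}$ with $n_i\in\{0,1\}$ is identified with the polynomial $n(x)=\sum_{i=0}^{m-1}n_ix^i\in G_m$. Every rational function over $\mathbb{Z}_2$ has a unique expansion in the field of formal Laurent series $\mathbb{Z}_2((x^{-1}))$. For $L(x)=\sum_{\ell=w}^{-\infty}a_\ell x^\ell\in\mathbb{Z}_2((x^{-1}))$ (a sum over descending $\ell\le w$, with $a_\ell:=0$ for $\ell>w$) set $\nu_m(L(x)):=\sum_{\ell=1}^m a_{-\ell}2^{-\ell}\in\mathbb{Q}_{2^m}$. Korobov polynomial lattice point set: for $q\in G_m$, $P_p(q)=\{\bm x_0(q),\dots,\bm x_{2^m-1}(q)\}\subseteq\mathbb{Q}_{2^m}^s$,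 where $\bm x_n(q)=\left(\nu_m\left(\frac{n(x)}{p(x)}\right),\nu_m\left(\frac{n(x)q(x)}{p(x)}\right),\ldots,\nu_m\left(\frac{n(x)q(x)^{s-1}}{p(x)}\right)\right)$ for $n=0,\dots,2^m-1$; the powers $1,q,\ldots,q^{s-1}$ are reduced modulo $p$, i.e. regarded as elements of $G_m$. Digital shift: for $x=\sum_{i=1}^m\xi_i2^{-i}$ and $\sigma=\sum_{i=1}^m\varsigma_i2^{-i}$ in $\mathbb{Q}_{2^m}$ with binary digits $\xi_i,\varsigma_i\in\mathbb{Z}_2$, $x\oplus\sigma:=\sum_{i=1}^m(\xi_i\oplus\varsigma_i)2^{-i}$; for vectors in $\mathbb{Q}_{2^m}^s$ it is defined componentwise, and for a point set $P=\{\bm x_0,\dots,\bm x_{N-1}\}\subseteq\mathbb{Q}_{2^m}^s$, $P\oplus\boldsymbol\sigma:=\{\bm x_0\oplus\boldsymbol\sigma,\dots,\bm x_{N-1}\oplus\boldsymbol\sigma\}$. *)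

theory Defs
  imports
    "HOL-Probability.Probability"
    "HOL-Computational_Algebra.Computational_Algebra"
    "HOL-Library.Z2"
begin

text \<open>
  The field with two elements is the type \<^typ>\<open>bit\<close> from \<^theory>\<open>HOL-Library.Z2\<close>.
  Points of the \<open>s\<close>-dimensional unit cube are functions \<^typ>\<open>nat \<Rightarrow> real\<close> that are extensional
  on \<open>{..<s}\<close>, i.e. elements of \<open>{..<s} \<rightarrow>\<^sub>E {0..1}\<close>; coordinates are numbered from 0.
\<close>

definition dyadics :: "nat \<Rightarrow> real set" where
  "dyadics m = (\<lambda>k. real k / 2 ^ m) ` {..<2 ^ m}"

definition dyadic_points :: "nat \<Rightarrow> nat \<Rightarrow> (nat \<Rightarrow> real) set" where
  "dyadic_points s m = {..<s} \<rightarrow>\<^sub>E dyadics m"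


subsection \<open>Star discrepancy\<close>

definition anchored_box :: "nat \<Rightarrow> (nat \<Rightarrow> real) \<Rightarrow> (nat \<Rightarrow> real) set" where
  "anchored_box s z = (\<Pi>\<^sub>E j\<in>{..<s}. {0..<z j})"

definition star_discrepancy :: "nat \<Rightarrow> (nat \<Rightarrow> real) multiset \<Rightarrow> real" where
  "star_discrepancy s P =
     (SUP z \<in> {..<s} \<rightarrow>\<^sub>E {0..1}.
        \<bar>(\<Sum>x\<in>#P. indicator (anchored_box s z) x) / real (size P)
          - measure (\<Pi>\<^sub>M j\<in>{..<s}. lborel) (anchored_box s z)\<bar>)"


subsection \<open>Korobov polynomial lattice point sets\<close>

definition nat_poly :: "nat \<Rightarrow> nat \<Rightarrow> bit poly" where
  "nat_poly m n = (\<Sum>i<m. monom (of_nat (n div 2 ^ i)) i)"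

text \<open>
  Laurent series in \<open>x\<^sup>-\<^sup>1\<close> are modelled by \<^typ>\<open>bit fls\<close>, the indeterminate of which plays the
  role of \<open>x\<^sup>-\<^sup>1\<close>. So \<open>x\<close> itself is \<^const>\<open>fls_X_inv\<close>, and the coefficient of \<open>x\<^bsup>-l\<^esup>\<close> in \<open>L\<close> is
  \<^term>\<open>fls_nth L l\<close>.
\<close>

definition poly_to_laurent :: "bit poly \<Rightarrow> bit fls" where
  "poly_to_laurent q = poly (map_poly fls_const q) fls_X_inv"

definition nu :: "nat \<Rightarrow> bit fls \<Rightarrow> real" where
  "nu m L = (\<Sum>l=1..m. of_bit (fls_nth L (int l)) / 2 ^ l)"

definition korobov_point :: "nat \<Rightarrow> nat \<Rightarrow> bit poly \<Rightarrow> bit poly \<Rightarrow> nat \<Rightarrow> (nat \<Rightarrow> real)" where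
  "korobov_point s m p q n =
     (\<lambda>j\<in>{..<s}. nu m (poly_to_laurent (nat_poly m n * (q ^ j mod p)) / poly_to_laurent p))"

definition korobov_point_set :: "nat \<Rightarrow> nat \<Rightarrow> bit poly \<Rightarrow> bit poly \<Rightarrow> (nat \<Rightarrow> real) multiset" where
  "korobov_point_set s m p q = image_mset (korobov_point s m p q) (mset_set {..<2 ^ m})"


subsection \<open>Digital shifts\<close>

text \<open>For \<open>x \<in> [0,1)\<close> and \<open>i \<ge> 1\<close>, \<open>bin_digit x i\<close> is the coefficient of \<open>2\<^bsup>-i\<^esup>\<close>:
  the parity of \<open>\<lfloor>2\<^sup>i x\<rfloor>\<close>, as an element of the field with two elements.\<close>

definition bin_digit :: "real \<Rightarrow> nat \<Rightarrow> bit" where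
  "bin_digit x i = of_int \<lfloor>2 ^ i * x\<rfloor>"

definition digital_add :: "nat \<Rightarrow> real \<Rightarrow> real \<Rightarrow> real" where
  "digital_add m x y = (\<Sum>i=1..m. of_bit (bin_digit x i + bin_digit y i) / 2 ^ i)"

definition digital_shift ::
    "nat \<Rightarrow> nat \<Rightarrow> (nat \<Rightarrow> real) multiset \<Rightarrow> (nat \<Rightarrow> real) \<Rightarrow> (nat \<Rightarrow> real) multiset" where
  "digital_shift s m P \<sigma> = image_mset (\<lambda>x. \<lambda>j\<in>{..<s}. digital_add m (x j) (\<sigma> j)) P"


definition shifted_korobov_union ::
    "nat \<Rightarrow> nat \<Rightarrow> bit poly \<Rightarrow> (nat \<Rightarrow> nat \<Rightarrow> real) \<Rightarrow> (nat \<Rightarrow> real) multiset" where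
  "shifted_korobov_union s m p \<sigma> =
     (\<Sum>r<2 ^ m. digital_shift s m (korobov_point_set s m p (nat_poly m r)) (\<sigma> (Suc r)))"

definition C\<^sub>0 :: real where
  "C\<^sub>0 = 1 / 3 * (1 + sqrt (1 + 18 / ln 3))"

end

theory Submission
  imports Defs
begin

text \<open>
  The proof is a second-moment argument for each box followed by a union bound.

  Since the coordinates of the points of \<open>Q\<close> are multiples of \<open>2\<^sup>-\<^sup>m\<close>, a box \<open>[0,z)\<close> contains the
  same points of \<open>Q\<close> after each coordinate of \<open>z\<close> is rounded up to a multiple of \<open>2\<^sup>-\<^sup>m\<close>, and its
  volume changes by at most \<open>s/2\<^sup>m\<close> (\<open>star_discrepancy_shifted_korobov_le\<close>). It remains to control \<open>(2\<^sup>m + 1)\<^sup>s\<close> boxes.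
  Let \<open>f\<close> be the indicator of such a box minus its volume; it has mean zero over the dyadic points.
  The deviation of \<open>Q\<close> in this box is \<open>2\<^sup>-\<^sup>m\<close> times a sum over \<open>q\<close> of the independent variables
  \<open>P\<^sub>q f (\<sigma>\<^sub>q)\<close>, where \<open>P\<^sub>q f (x)\<close> is the mean of \<open>f\<close> over the lattice of \<open>q\<close> shifted by \<open>x\<close>.
  These variables are centred and bounded by 1.

  The point is that their variances add up to at most \<open>s - 1\<close>, although there are \<open>2\<^sup>m\<close> of them. The
  operators \<open>P\<^sub>q\<close> are commuting orthogonal projections. By a Vandermonde argument modulo
  the irreducible polynomial \<open>p\<close>, any \<open>s\<close> different lattices together generate the
  whole group of shifts, so a product of \<open>s\<close> different \<open>P\<^sub>q\<close> averages over all dyadic points and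
  kills \<open>f\<close> (\<open>foldr_lattice_mean_eq_0\<close>). In a joint eigenbasis every vector that occurs in \<open>f\<close> is
  thus fixed by at most \<open>s - 1\<close> of the projections, whence
  \<open>\<Sum>\<^sub>q \<parallel>P\<^sub>q f\<parallel>\<^sup>2 \<le> (s - 1) \<parallel>f\<parallel>\<^sup>2\<close> (\<open>commuting_projections_sum_le\<close>, proved by induction and
  without eigenvectors).

  From \<open>exp y \<le> 1 + y + y\<^sup>2\<close> on \<open>[-1,1]\<close> one gets the tail bound \<open>2 exp (s - 1 - t)\<close> for the
  absolute value of the sum, and the union bound over all boxes yields the theorem: a discrepancy of
  order \<open>1/2\<^sup>m = N\<^sup>-\<^sup>1\<^sup>/\<^sup>2\<close>, up to the factor that comes from the number of boxes.
\<close>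

section \<open>Polynomials over the field with two elements and their Laurent quotients\<close>

lemma add_self_bit: "(b::bit) + b = 0" by (cases b) auto

lemma add_self_bit_poly: "(q :: bit poly) + q = 0"
  by (rule poly_eqI) (simp only: coeff_add add_self_bit coeff_0)

lemma minus_eq_plus_bit_poly: "(a :: bit poly) - b = a + b"
  by (rule poly_eqI) (simp only: coeff_add coeff_diff minus_bit_def)

lemma coeff_nat_poly: "coeff (nat_poly m n) i = (if i < m then of_nat (n div 2 ^ i) else 0)"
  unfolding nat_poly_def coeff_sum coeff_monom by (simp add: sum.delta)

lemma degree_nat_poly_less: "m \<ge> 1 \<Longrightarrow> degree (nat_poly m n) < m"
  by (rule degree_lessI) (auto simp: coeff_nat_poly)

lemma bij_betw_nat_poly:
  assumes "m \<ge> 1"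
  shows "bij_betw (nat_poly m) {..<2 ^ m} {q. degree q < m}"
proof (rule bij_betw_imageI)
  show "inj_on (nat_poly m) {..<2 ^ m}"
  proof (rule inj_onI)
    fix a b :: nat
    assume ab: "a \<in> {..<2 ^ m}" "b \<in> {..<2 ^ m}" and eq: "nat_poly m a = nat_poly m b"
    have "odd (a div 2 ^ i) \<longleftrightarrow> odd (b div 2 ^ i)" if "i < m" for i
    proof -
      have "(of_nat (a div 2 ^ i) :: bit) = of_nat (b div 2 ^ i)"
        using arg_cong[OF eq, of "\<lambda>q. coeff q i"] that by (simp add: coeff_nat_poly)
      then show ?thesis by (metis even_of_nat)
    qed
    moreover have "a div 2 ^ i = 0" "b div 2 ^ i = 0" if "\<not> i < m" for i
    proof -
      have "(2::nat) ^ m \<le> 2 ^ i" using that by simp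
      then have "a < 2 ^ i" "b < 2 ^ i" using ab by (auto intro: order.strict_trans2)
      then show "a div 2 ^ i = 0" "b div 2 ^ i = 0" by simp_all
    qed
    ultimately have "bit a i = bit b i" for i unfolding bit_iff_odd by metis
    then show "a = b" by (simp add: bit_eq_iff)
  qed
  \<comment> \<open>The constant coefficient of the polynomial is the last binary digit of its number.\<close>
  have surj: "\<exists>n < 2 ^ k. \<forall>i<k. coeff q i = of_nat (n div 2 ^ i)" for q :: "bit poly" and k
  proof (induction k arbitrary: q)
    case 0
    then show ?case by simp
  next
    case (Suc k)
    obtain a q' where q: "q = pCons a q'" by (cases q)
    obtain n where n: "n < 2 ^ k" "\<And>i. i < k \<Longrightarrow> coeff q' i = of_nat (n div 2 ^ i)"
      using Suc[of q'] by blast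
    define n' where "n' = 2 * n + of_bit a"
    have "n' < 2 ^ Suc k" using n(1) by (auto simp: n'_def of_bool_def)
    moreover have "coeff q i = of_nat (n' div 2 ^ i)" if "i < Suc k" for i
    proof (cases i)
      case 0
      then show ?thesis by (cases a) (simp_all add: q n'_def)
    next
      case (Suc j)
      have "n' div 2 ^ i = n div 2 ^ j"
        by (simp add: Suc n'_def div_mult2_eq of_bool_def)
      then show ?thesis using n(2)[of j] that by (simp add: q Suc)
    qed
    ultimately show ?case by blast
  qed
  show "nat_poly m ` {..<2 ^ m} = {q. degree q < m}"
  proof (intro equalityI subsetI)
    fix q :: "bit poly" assume "q \<in> {q. degree q < m}"
    then have dq: "degree q < m" by simp
    obtain n where n: "n < 2 ^ m" "\<forall>i<m. coeff q i = of_nat (n div 2 ^ i)" using surj by blast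
    have "q = nat_poly m n"
      using n(2) dq by (intro poly_eqI) (auto simp: coeff_nat_poly coeff_eq_0)
    then show "q \<in> nat_poly m ` {..<2 ^ m}" using n(1) by auto
  qed (use assms degree_nat_poly_less in auto)
qed

lemma fls_nth_poly_to_laurent:
  "fls_nth (poly_to_laurent q) k = (if k \<le> 0 then coeff q (nat (- k)) else 0)"
proof (induction q arbitrary: k)
  case 0
  then show ?case by (simp add: poly_to_laurent_def)
next
  case (pCons a q)
  have "poly_to_laurent (pCons a q) = fls_const a + fls_X_inv * poly_to_laurent q"
    by (simp add: poly_to_laurent_def map_poly_pCons)
  then have "fls_nth (poly_to_laurent (pCons a q)) k
      = (if k = 0 then a else 0) + fls_nth (poly_to_laurent q) (k + 1)"
    by (simp add: fls_X_inv_times_conv_shift del: add_bit_eq_xor)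
  also have "\<dots> = (if k \<le> 0 then coeff (pCons a q) (nat (- k)) else 0)"
  proof -
    have "nat (- k) = Suc (nat (- (k + 1)))" if "k < 0" using that by simp
    then show ?thesis unfolding pCons by auto
  qed
  finally show ?case .
qed

lemma poly_to_laurent_add: "poly_to_laurent (a + b) = poly_to_laurent a + poly_to_laurent b"
  by (rule fls_eqI) (simp add: fls_nth_poly_to_laurent del: add_bit_eq_xor)

lemma poly_to_laurent_mult: "poly_to_laurent (a * b) = poly_to_laurent a * poly_to_laurent b"
proof (induction a)
  case 0
  then show ?case by (simp add: poly_to_laurent_def)
next
  case (pCons c a)
  have shift: "poly_to_laurent (pCons 0 r) = fls_X_inv * poly_to_laurent r" for r
    by (simp add: poly_to_laurent_def map_poly_pCons)
  have const: "poly_to_laurent (smult c r) = fls_const c * poly_to_laurent r" for r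
    by (rule fls_eqI) (simp add: fls_nth_poly_to_laurent del: mult_bit_eq_and)
  have "poly_to_laurent (pCons c a) = fls_const c + fls_X_inv * poly_to_laurent a"
    by (simp add: poly_to_laurent_def map_poly_pCons)
  moreover have "pCons c a * b = smult c b + pCons 0 (a * b)" by simp
  ultimately show ?case
    by (simp add: poly_to_laurent_add shift const pCons algebra_simps del: mult_pCons_left)
qed

lemma poly_to_laurent_eq_0_iff: "poly_to_laurent q = 0 \<longleftrightarrow> q = 0"
proof
  assume 0: "poly_to_laurent q = 0"
  show "q = 0"
  proof (rule poly_eqI)
    fix i
    show "coeff q i = coeff 0 i"
      using arg_cong[OF 0, of "\<lambda>L. fls_nth L (- int i)"] by (simp add: fls_nth_poly_to_laurent)
  qed
qed (simp add: poly_to_laurent_def)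

lemma fls_subdegree_poly_to_laurent:
  "q \<noteq> 0 \<Longrightarrow> fls_subdegree (poly_to_laurent q) = - int (degree q)"
  by (rule fls_subdegree_eqI) (auto simp: fls_nth_poly_to_laurent coeff_eq_0 simp del: bit_not_zero_iff)

definition laurent_digit :: "bit poly \<Rightarrow> bit poly \<Rightarrow> nat \<Rightarrow> bit" where
  "laurent_digit p a i = fls_nth (poly_to_laurent a / poly_to_laurent p) (int i)"

lemma laurent_digit_add: "laurent_digit p (a + b) i = laurent_digit p a i + laurent_digit p b i"
  by (simp add: laurent_digit_def poly_to_laurent_add add_divide_distrib del: add_bit_eq_xor)

text \<open>Write \<open>a = dp + c\<close> with \<open>deg c < deg p\<close>. The polynomial part \<open>d\<close> of \<open>a/p\<close> has no digits after the
  point, and if \<open>c \<noteq> 0\<close> then the leading digit of \<open>c/p\<close> stands in place \<open>deg p - deg c\<close>, which lies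
  between 1 and \<open>deg p\<close>. So the first \<open>deg p\<close> digits determine \<open>a\<close> modulo \<open>p\<close>.\<close>

lemma dvd_of_laurent_digits_zero:
  assumes "p \<noteq> 0" and "\<And>i. 1 \<le> i \<Longrightarrow> i \<le> degree p \<Longrightarrow> laurent_digit p a i = 0"
  shows "p dvd a"
proof (rule ccontr)
  assume "\<not> p dvd a"
  define c where "c = a mod p"
  have c: "c \<noteq> 0" using \<open>\<not> p dvd a\<close> by (auto simp: c_def)
  have deg: "degree c < degree p" using c degree_mod_less'[OF \<open>p \<noteq> 0\<close>] by (simp add: c_def)
  have L0: "poly_to_laurent p \<noteq> 0" "poly_to_laurent c \<noteq> 0"
    using assms(1) c by (simp_all add: poly_to_laurent_eq_0_iff)
  have "a = (a div p) * p + c" by (simp add: c_def)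
  then have "poly_to_laurent a / poly_to_laurent p
      = poly_to_laurent (a div p) + poly_to_laurent c / poly_to_laurent p"
    using L0(1) by (metis add_divide_distrib nonzero_mult_div_cancel_right
        poly_to_laurent_add poly_to_laurent_mult)
  moreover have sub: "fls_subdegree (poly_to_laurent c / poly_to_laurent p)
      = int (degree p - degree c)"
    using c assms(1) deg by (simp add: fls_divide_subdegree L0 fls_subdegree_poly_to_laurent)
  moreover have "poly_to_laurent c / poly_to_laurent p \<noteq> 0" using L0 by simp
  ultimately have "laurent_digit p a (degree p - degree c) \<noteq> 0"
    using deg nth_fls_subdegree_nonzero[of "poly_to_laurent c / poly_to_laurent p"]
    by (simp add: laurent_digit_def fls_nth_poly_to_laurent)
  then show False using assms(2)[of "degree p - degree c"] deg by simp
qed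

section \<open>Binary digits\<close>

definition of_digits :: "nat \<Rightarrow> (nat \<Rightarrow> bit) \<Rightarrow> real" where
  "of_digits m b = (\<Sum>i=1..m. of_bit (b i) / 2 ^ i)"

lemma of_digits_Suc: "of_digits (Suc m) b = of_digits m b + of_bit (b (Suc m)) / 2 ^ Suc m"
  by (simp add: of_digits_def)

lemma of_digits_cong: "(\<And>i. 1 \<le> i \<Longrightarrow> i \<le> m \<Longrightarrow> b i = c i) \<Longrightarrow> of_digits m b = of_digits m c"
  unfolding of_digits_def by (rule sum.cong) auto

lemma of_digits_eq_fraction: "\<exists>k<2 ^ m. of_digits m b = real k / 2 ^ m"
proof (induction m)
  case 0
  then show ?case by (simp add: of_digits_def)
next
  case (Suc m)
  then obtain k where k: "k < 2 ^ m" "of_digits m b = real k / 2 ^ m" by blast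
  have "2 * k + of_bool (odd (b (Suc m))) < 2 ^ Suc m" using k(1) by (auto simp: of_bool_def)
  moreover have "of_digits (Suc m) b = real (2 * k + of_bool (odd (b (Suc m)))) / 2 ^ Suc m"
    by (simp add: of_digits_Suc k(2) field_simps)
  ultimately show ?case by blast
qed

lemma of_digits_in_dyadics: "of_digits m b \<in> dyadics m"
  using of_digits_eq_fraction[of m b] by (auto simp: dyadics_def)

text \<open>The digits after place \<open>i\<close> contribute strictly less than \<open>2\<^sup>-\<^sup>i\<close>; the exact geometric bound is
  the form that passes through the induction.\<close>

lemma of_digits_tail:
  assumes "i \<le> m"
  shows "0 \<le> of_digits m b - of_digits i b \<and> of_digits m b - of_digits i b \<le> 1 / 2 ^ i - 1 / 2 ^ m"
  using assms
proof (induction m rule: dec_induct)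
  case (step m)
  define e where "e = 1 / (2::real) ^ Suc m"
  have "1 / (2::real) ^ m = 2 * e" "0 < e" by (simp_all add: e_def)
  moreover have "of_digits (Suc m) b = of_digits m b \<or> of_digits (Suc m) b = of_digits m b + e"
    by (cases "b (Suc m)") (simp_all add: of_digits_Suc e_def)
  ultimately show ?case using step.IH unfolding e_def[symmetric] by linarith
qed simp

lemma bin_digit_of_digits:
  assumes "1 \<le> i" "i \<le> m"
  shows "bin_digit (of_digits m b) i = b i"
proof -
  obtain l where l: "i = Suc l" using assms(1) by (cases i) auto
  obtain k where k: "of_digits l b = real k / 2 ^ l" using of_digits_eq_fraction by blast
  \<comment> \<open>The integer formed by the first \<open>i\<close> digits, which is the integer part of \<open>2\<^sup>i\<close> times the number.\<close>
  define K where "K = 2 * int k + of_bool (odd (b i))"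
  have "of_digits i b = real_of_int K / 2 ^ i"
    by (simp add: l of_digits_Suc k K_def field_simps)
  moreover have "0 \<le> of_digits m b - of_digits i b" "of_digits m b - of_digits i b < 1 / 2 ^ i"
    using of_digits_tail[OF assms(2), of b] zero_less_divide_1_iff[of "2 ^ m :: real"]
    by (auto intro: order.strict_trans1 simp del: zero_less_divide_1_iff)
  ultimately have "real_of_int K / 2 ^ i \<le> of_digits m b" "of_digits m b < (real_of_int K + 1) / 2 ^ i"
    by (simp_all add: add_divide_distrib)
  then have "\<lfloor>2 ^ i * of_digits m b\<rfloor> = K"
    by (intro floor_unique) (simp_all add: pos_divide_le_eq pos_less_divide_eq mult.commute)
  then show ?thesis by (cases "b i") (simp_all add: bin_digit_def K_def)
qed

lemma of_digits_bin_digit_floor: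
  assumes "0 \<le> x" "x < 1"
  shows "of_digits m (bin_digit x) = real_of_int \<lfloor>2 ^ m * x\<rfloor> / 2 ^ m"
proof (induction m)
  case 0
  have "\<lfloor>x\<rfloor> = 0" using assms by linarith
  then show ?case by (simp add: of_digits_def)
next
  case (Suc m)
  define f where "f = \<lfloor>2 ^ m * x\<rfloor>"
  have "\<lfloor>2 ^ Suc m * x\<rfloor> = 2 * f \<or> \<lfloor>2 ^ Suc m * x\<rfloor> = 2 * f + 1"
    unfolding f_def power_Suc mult.assoc by linarith
  then have "real_of_int \<lfloor>2 ^ Suc m * x\<rfloor> = 2 * real_of_int f + of_bit (bin_digit x (Suc m))"
  proof (elim disjE)
    assume e: "\<lfloor>2 ^ Suc m * x\<rfloor> = 2 * f"
    show ?thesis unfolding bin_digit_def e by simp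
  next
    assume e: "\<lfloor>2 ^ Suc m * x\<rfloor> = 2 * f + 1"
    show ?thesis unfolding bin_digit_def e by simp
  qed
  then show ?case unfolding of_digits_Suc Suc.IH f_def[symmetric] by (simp add: field_simps)
qed

lemma of_digits_bin_digit:
  assumes "x \<in> dyadics m"
  shows "of_digits m (bin_digit x) = x"
proof -
  obtain k where k: "k < 2 ^ m" "x = real k / 2 ^ m" using assms by (auto simp: dyadics_def)
  have "real k < 2 ^ m" using k(1) by (metis of_nat_less_iff of_nat_numeral of_nat_power)
  then have "0 \<le> x" "x < 1" unfolding k(2) by simp_all
  moreover have "2 ^ m * x = real k" by (simp add: k(2))
  ultimately show ?thesis using of_digits_bin_digit_floor[of x m] by (simp add: k(2))
qed

lemma inj_on_fraction: "inj_on (\<lambda>k. real k / 2 ^ m) A"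
  by (rule inj_onI) simp

lemma finite_dyadic_points: "finite (dyadic_points s m)"
  unfolding dyadic_points_def dyadics_def by (intro finite_PiE) auto

lemma card_dyadic_points: "card (dyadic_points s m) = (2 ^ m) ^ s"
  by (simp add: dyadic_points_def dyadics_def card_PiE card_image inj_on_fraction)

section \<open>Digital translations of the dyadic points\<close>

text \<open>The digital shift of \<open>x\<close> by the point with coordinates \<open>\<nu>\<^sub>m(a\<^sub>j/p)\<close>. The vector \<open>a\<close> of polynomials,
  rather than that point, is the parameter because the lattice of \<open>q\<close> consists of the multiples
  \<open>a\<^sub>j = n q\<^sup>j\<close> of one vector, and translations compose by adding these vectors.\<close>

definition translate :: "nat \<Rightarrow> nat \<Rightarrow> bit poly \<Rightarrow> (nat \<Rightarrow> bit poly) \<Rightarrow> (nat \<Rightarrow> real) \<Rightarrow> nat \<Rightarrow> real"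
  where "translate s m p a x =
    (\<lambda>j\<in>{..<s}. of_digits m (\<lambda>i. bin_digit (x j) i + laurent_digit p (a j) i))"

lemma translate_mem: "translate s m p a x \<in> dyadic_points s m"
  by (auto simp: translate_def dyadic_points_def of_digits_in_dyadics)

lemma translate_translate:
  "translate s m p a (translate s m p b x) = translate s m p (\<lambda>j. a j + b j) x"
  unfolding translate_def
proof (rule restrict_ext)
  fix j assume "j \<in> {..<s}"
  then have j: "(\<lambda>j\<in>{..<s}. of_digits m (\<lambda>i. bin_digit (x j) i + laurent_digit p (b j) i)) j
      = of_digits m (\<lambda>i. bin_digit (x j) i + laurent_digit p (b j) i)" by (simp only: restrict_apply if_True)
  show "of_digits m (\<lambda>i. bin_digit ((\<lambda>j\<in>{..<s}. of_digits m (\<lambda>i. bin_digit (x j) i + laurent_digit p (b j) i)) j) i + laurent_digit p (a j) i)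
    = of_digits m (\<lambda>i. bin_digit (x j) i + laurent_digit p (a j + b j) i)"
    unfolding j by (rule of_digits_cong) (simp only: bin_digit_of_digits laurent_digit_add ac_simps)
qed

lemma translate_zero:
  assumes "x \<in> dyadic_points s m"
  shows "translate s m p (\<lambda>_. 0) x = x"
proof -
  have 0: "laurent_digit p 0 i = 0" for i by (simp add: laurent_digit_def poly_to_laurent_def)
  have "x j \<in> dyadics m" if "j < s" for j
    using assms that by (auto simp: dyadic_points_def)
  moreover have "x \<in> extensional {..<s}" using assms by (auto simp: dyadic_points_def PiE_def)
  ultimately show ?thesis
    unfolding translate_def 0 add_0_right
    by (intro ext) (simp add: of_digits_bin_digit extensional_def restrict_def)
qed

text \<open>In characteristic 2 every translation is its own inverse.\<close>

lemma bij_betw_translate: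
  "bij_betw (translate s m p a) (dyadic_points s m) (dyadic_points s m)"
proof (rule bij_betwI)
  have "translate s m p a (translate s m p a x) = x" if "x \<in> dyadic_points s m" for x
    unfolding translate_translate add_self_bit_poly using that by (rule translate_zero)
  then show "\<And>x. x \<in> dyadic_points s m \<Longrightarrow> translate s m p a (translate s m p a x) = x"
    "\<And>x. x \<in> dyadic_points s m \<Longrightarrow> translate s m p a (translate s m p a x) = x"
    by blast+
qed (rule funcsetI, rule translate_mem)+

lemma dvd_of_translate_eq:
  assumes "p \<noteq> 0" "degree p = m" "j < s" "translate s m p a x = translate s m p b x"
  shows "p dvd a j - b j"
proof (rule dvd_of_laurent_digits_zero[OF assms(1)])
  fix i assume i: "1 \<le> i" "i \<le> degree p"
  have "of_digits m (\<lambda>i. bin_digit (x j) i + laurent_digit p (a j) i)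
      = of_digits m (\<lambda>i. bin_digit (x j) i + laurent_digit p (b j) i)"
    using fun_cong[OF assms(4), of j] assms(3) by (simp add: translate_def)
  from arg_cong[OF this, of "\<lambda>y. bin_digit y i"]
  have "bin_digit (x j) i + laurent_digit p (a j) i = bin_digit (x j) i + laurent_digit p (b j) i"
    unfolding bin_digit_of_digits[OF i(1) i(2)[unfolded assms(2)]] .
  then have "laurent_digit p (a j) i = laurent_digit p (b j) i" by (rule add_left_imp_eq)
  then show "laurent_digit p (a j - b j) i = 0"
    unfolding minus_eq_plus_bit_poly laurent_digit_add by (simp only: add_self_bit)
qed

section \<open>Commuting projections\<close>

text \<open>Split off one projection \<open>P\<^sub>a\<close> and apply the induction hypothesis to the two components of
  \<open>f = P\<^sub>a f + (f - P\<^sub>a f)\<close> separately. On the first component already products of \<open>t - 1\<close> of the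
  other projections vanish, so it contributes at most \<open>1 + (t - 2)\<close> times its squared norm, where the
  1 stands for the term of \<open>a\<close> in the sum. On the second component products of \<open>t\<close> others still
  vanish, which gives \<open>t - 1\<close>. Orthogonality enters through the Pythagorean identity for the squared
  seminorm \<open>N\<close>, so that no inner product has to be named.\<close>

lemma commuting_projections_sum_le:
  fixes P :: "'r \<Rightarrow> 'h::minus \<Rightarrow> 'h" and N :: "'h \<Rightarrow> real"
  assumes "finite R"
    and nonneg: "\<And>f. 0 \<le> N f"
    and pyth: "\<And>r f. r \<in> R \<Longrightarrow> N f = N (P r f) + N (f - P r f)"
    and diff: "\<And>r f g. r \<in> R \<Longrightarrow> P r (f - g) = P r f - P r g"
    and comm: "\<And>r r' f. r \<in> R \<Longrightarrow> r' \<in> R \<Longrightarrow> P r (P r' f) = P r' (P r f)"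
    and "t \<ge> 1"
    and "\<And>rs. distinct rs \<Longrightarrow> set rs \<subseteq> R \<Longrightarrow> length rs = t \<Longrightarrow> N (foldr P rs f) = 0"
  shows "(\<Sum>r\<in>R. N (P r f)) \<le> real (t - 1) * N f"
  using \<open>finite R\<close> pyth diff comm assms(6,7)
proof (induction R arbitrary: f t rule: finite_induct)
  case empty
  then show ?case using nonneg by simp
next
  case (insert a R)
  have a: "a \<in> insert a R" by simp
  note pyth = insert.prems(1) and diff = insert.prems(2) and comm = insert.prems(3)
  note t = insert.prems(4) and kill = insert.prems(5)
  have foldr_comm: "foldr P rs (P a g) = P a (foldr P rs g)" if "set rs \<subseteq> R" for rs g
    using that by (induction rs) (auto simp: comm[of a])
  have foldr_diff: "foldr P rs (g - h) = foldr P rs g - foldr P rs h" if "set rs \<subseteq> R" for rs g h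
    using that by (induction rs) (auto simp: diff)
  show ?case
  proof (cases "t = 1")
    case True
    have "N (P r f) = 0" if "r \<in> insert a R" for r
      using kill[of "[r]"] that True by simp
    then have "(\<Sum>r\<in>insert a R. N (P r f)) = 0" by (intro sum.neutral ballI)
    then show ?thesis using True by simp
  next
    case False
    have rest: "P r f - P a (P r f) = P r (f - P a f)" "P a (P r f) = P r (P a f)" if "r \<in> R" for r
      using that diff comm[of a r] by auto
    have "(\<Sum>r\<in>R. N (P r f)) = (\<Sum>r\<in>R. N (P r (P a f))) + (\<Sum>r\<in>R. N (P r (f - P a f)))"
      unfolding sum.distrib[symmetric] by (intro sum.cong refl) (metis rest pyth[OF a])
    also have "(\<Sum>r\<in>R. N (P r (P a f))) \<le> real (t - 1 - 1) * N (P a f)"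
    proof (rule insert.IH)
      fix rs assume rs: "distinct rs" "set rs \<subseteq> R" "length rs = t - 1"
      then show "N (foldr P rs (P a f)) = 0"
        using kill[of "rs @ [a]"] t insert.hyps by auto
    qed (use t False pyth diff comm in auto)
    also have "(\<Sum>r\<in>R. N (P r (f - P a f))) \<le> real (t - 1) * N (f - P a f)"
    proof (rule insert.IH)
      fix rs assume rs: "distinct rs" "set rs \<subseteq> R" "length rs = t"
      define g where "g = foldr P rs f"
      have "N g = 0" using kill[of rs] rs by (auto simp: g_def)
      then have "N (g - P a g) = 0"
        using pyth[OF a, of g] nonneg[of "P a g"] nonneg[of "g - P a g"] by linarith
      then show "N (foldr P rs (f - P a f)) = 0"
        using rs by (simp add: foldr_diff foldr_comm g_def)
    qed (use t pyth diff comm in auto)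
    finally have "(\<Sum>r\<in>insert a R. N (P r f))
        \<le> N (P a f) + real (t - 1 - 1) * N (P a f) + real (t - 1) * N (f - P a f)"
      using insert.hyps by simp
    also have "\<dots> = real (t - 1) * N f"
      unfolding pyth[OF a, of f] using t False by (simp add: algebra_simps of_nat_diff)
    finally show ?thesis .
  qed
qed

section \<open>Averages over shifted lattices\<close>

text \<open>The mean of \<open>f\<close> over the lattice \<open>P\<^sub>p(q)\<close> shifted by \<open>x\<close>; as an operator on functions of the
  dyadic points it is the orthogonal projection onto the functions invariant under that lattice.\<close>

definition lattice_mean ::
    "nat \<Rightarrow> nat \<Rightarrow> bit poly \<Rightarrow> bit poly \<Rightarrow> ((nat \<Rightarrow> real) \<Rightarrow> real) \<Rightarrow> (nat \<Rightarrow> real) \<Rightarrow> real"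
  where "lattice_mean s m p q f x =
    (\<Sum>n | degree n < m. f (translate s m p (\<lambda>j. n * (q ^ j mod p)) x)) / 2 ^ m"

lemma finite_polys_degree_less: "finite {n :: bit poly. degree n < m}"
proof (cases "m \<ge> 1")
  case True
  then show ?thesis using bij_betw_finite[OF bij_betw_nat_poly] by blast
qed auto

lemma card_polys_degree_less: "m \<ge> 1 \<Longrightarrow> card {n :: bit poly. degree n < m} = 2 ^ m"
  using bij_betw_same_card[OF bij_betw_nat_poly] by fastforce

lemma lattice_mean_diff:
  "lattice_mean s m p q (f - g) = lattice_mean s m p q f - lattice_mean s m p q g"
  by (rule ext) (simp add: lattice_mean_def sum_subtractf diff_divide_distrib)

lemma translate_commute:
  "translate s m p a (translate s m p b x) = translate s m p b (translate s m p a x)"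
  by (simp only: translate_translate add.commute)

lemma lattice_mean_commute:
  "lattice_mean s m p q (lattice_mean s m p r f) = lattice_mean s m p r (lattice_mean s m p q f)"
proof (rule ext)
  fix x
  show "lattice_mean s m p q (lattice_mean s m p r f) x = lattice_mean s m p r (lattice_mean s m p q f) x"
    unfolding lattice_mean_def sum_divide_distrib[symmetric]
    by (subst sum.swap) (simp only: translate_commute)
qed

lemma lattice_mean_translate:
  assumes "\<And>y. f (translate s m p a y) = f y"
  shows "lattice_mean s m p q f (translate s m p a x) = lattice_mean s m p q f x"
  unfolding lattice_mean_def translate_commute[of _ _ _ _ a] assms ..

text \<open>The lattice is a group, so a further shift by one of its elements permutes the points averaged.\<close>

lemma lattice_mean_invariant:
  assumes "degree n < m"
  shows "lattice_mean s m p q f (translate s m p (\<lambda>j. n * (q ^ j mod p)) x) = lattice_mean s m p q f x"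
proof -
  have bij: "bij_betw (\<lambda>k. k + n) {k. degree k < m} {k. degree k < m}"
  proof (rule bij_betwI[where g = "\<lambda>k. k + n"])
    show "(\<lambda>k. k + n) \<in> {k. degree k < m} \<rightarrow> {k. degree k < m}"
      "(\<lambda>k. k + n) \<in> {k. degree k < m} \<rightarrow> {k. degree k < m}"
      using assms by (auto intro: degree_add_less)
  qed (simp_all only: add.assoc add_self_bit_poly add_0_right)
  have "(\<Sum>k | degree k < m. f (translate s m p (\<lambda>j. k * (q ^ j mod p))
          (translate s m p (\<lambda>j. n * (q ^ j mod p)) x)))
      = (\<Sum>k | degree k < m. f (translate s m p (\<lambda>j. (k + n) * (q ^ j mod p)) x))"
    by (simp only: translate_translate distrib_right)
  also have "\<dots> = (\<Sum>k | degree k < m. f (translate s m p (\<lambda>j. k * (q ^ j mod p)) x))"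
    by (rule sum.reindex_bij_betw[OF bij])
  finally show ?thesis by (simp only: lattice_mean_def)
qed

lemma sum_translate:
  "(\<Sum>x\<in>dyadic_points s m. f (translate s m p a x)) = (\<Sum>x\<in>dyadic_points s m. f x)"
  by (rule sum.reindex_bij_betw[OF bij_betw_translate])

text \<open>Self-adjointness, tested against an invariant function \<open>g\<close>; it is what makes the mean an orthogonal
  projection.\<close>

lemma sum_lattice_mean_mult:
  assumes "m \<ge> 1"
    and "\<And>n x. degree n < m \<Longrightarrow> g (translate s m p (\<lambda>j. n * (q ^ j mod p)) x) = g x"
  shows "(\<Sum>x\<in>dyadic_points s m. lattice_mean s m p q f x * g x) = (\<Sum>x\<in>dyadic_points s m. f x * g x)"
proof -
  let ?T = "\<lambda>n. translate s m p (\<lambda>j. n * (q ^ j mod p))"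
  have "(\<Sum>x\<in>dyadic_points s m. lattice_mean s m p q f x * g x)
      = (\<Sum>n | degree n < m. \<Sum>x\<in>dyadic_points s m. f (?T n x) * g x) / 2 ^ m"
    unfolding lattice_mean_def by (subst sum.swap) (simp add: sum_distrib_right sum_divide_distrib)
  also have "(\<Sum>n | degree n < m. \<Sum>x\<in>dyadic_points s m. f (?T n x) * g x)
      = (\<Sum>n | degree n < m. \<Sum>x\<in>dyadic_points s m. f (?T n x) * g (?T n x))"
    using assms(2) by (intro sum.cong) auto
  also have "\<dots> = (\<Sum>n::bit poly | degree n < m. \<Sum>x\<in>dyadic_points s m. f x * g x)"
    by (intro sum.cong refl sum_translate[of "\<lambda>x. f x * g x"])
  also have "\<dots> / 2 ^ m = (\<Sum>x\<in>dyadic_points s m. f x * g x)"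
    by (simp add: card_polys_degree_less[OF assms(1)])
  finally show ?thesis .
qed

lemma sum_lattice_mean:
  "m \<ge> 1 \<Longrightarrow> (\<Sum>x\<in>dyadic_points s m. lattice_mean s m p q f x) = (\<Sum>x\<in>dyadic_points s m. f x)"
  using sum_lattice_mean_mult[of m "\<lambda>_. 1"] by simp

text \<open>With \<open>g\<close> the mean of \<open>f\<close>, testing \<open>f\<close> against the invariant function \<open>g\<close> gives
  \<open>\<langle>g, g\<rangle> = \<langle>f, g\<rangle>\<close>, that is, \<open>f - g\<close> is orthogonal to \<open>g\<close>.\<close>

lemma lattice_mean_pythagoras:
  assumes "m \<ge> 1"
  shows "(\<Sum>x\<in>dyadic_points s m. (f x)\<^sup>2) = (\<Sum>x\<in>dyadic_points s m. (lattice_mean s m p q f x)\<^sup>2)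
    + (\<Sum>x\<in>dyadic_points s m. ((f - lattice_mean s m p q f) x)\<^sup>2)"
proof -
  define g where "g = lattice_mean s m p q f"
  have "(\<Sum>x\<in>dyadic_points s m. g x * g x) = (\<Sum>x\<in>dyadic_points s m. f x * g x)"
    unfolding g_def using assms lattice_mean_invariant by (intro sum_lattice_mean_mult) auto
  moreover have "(\<Sum>x\<in>dyadic_points s m. (f x)\<^sup>2) = (\<Sum>x\<in>dyadic_points s m. ((f - g) x)\<^sup>2)
      + 2 * (\<Sum>x\<in>dyadic_points s m. f x * g x) - (\<Sum>x\<in>dyadic_points s m. g x * g x)"
    unfolding sum_distrib_left sum.distrib[symmetric] sum_subtractf[symmetric]
    by (intro sum.cong refl) (simp add: power2_eq_square algebra_simps)
  ultimately show ?thesis by (simp add: g_def[symmetric] power2_eq_square)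
qed

lemma lattice_mean_cong:
  assumes "\<And>x. x \<in> dyadic_points s m \<Longrightarrow> f x = g x"
  shows "lattice_mean s m p q f = lattice_mean s m p q g"
  by (rule ext) (simp add: lattice_mean_def assms translate_mem)

lemma lattice_mean_const: "m \<ge> 1 \<Longrightarrow> lattice_mean s m p q (\<lambda>_. c) = (\<lambda>_. c)"
  by (rule ext) (simp add: lattice_mean_def card_polys_degree_less)

lemma abs_lattice_mean_le:
  assumes "m \<ge> 1" "\<And>x. \<bar>f x\<bar> \<le> B"
  shows "\<bar>lattice_mean s m p q f x\<bar> \<le> B"
proof -
  have "\<bar>\<Sum>n | degree n < m. f (translate s m p (\<lambda>j. n * (q ^ j mod p)) x)\<bar>
      \<le> (\<Sum>n::bit poly | degree n < m. B)"
    by (rule order.trans[OF sum_abs sum_mono]) (rule assms)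
  then show ?thesis
    unfolding lattice_mean_def abs_divide
    by (simp add: card_polys_degree_less[OF assms(1)] pos_divide_le_eq mult.commute)
qed

section \<open>Independence of different lattices\<close>

text \<open>Instead of a determinant one uses the polynomial \<open>h\<close> with roots \<open>r\<^sub>k\<close>, \<open>k \<noteq> i\<close>. It has degree below
  \<open>s\<close>, so \<open>\<Sum>\<^sub>l n\<^sub>l h(r\<^sub>l)\<close> is a combination of the given power sums and is divisible by \<open>p\<close>; but only
  the term \<open>n\<^sub>i h(r\<^sub>i)\<close> survives in it, and \<open>p\<close> does not divide \<open>h(r\<^sub>i)\<close>.\<close>

lemma vandermonde_dvd:
  fixes p :: "'a :: idom"
  assumes p: "prime_elem p"
    and distinct: "\<And>i k. i < s \<Longrightarrow> k < s \<Longrightarrow> i \<noteq> k \<Longrightarrow> \<not> p dvd r i - r k"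
    and dvd: "\<And>j. j < s \<Longrightarrow> p dvd (\<Sum>i<s. n i * r i ^ j)"
    and i: "i < s"
  shows "p dvd n i"
proof -
  define h where "h = (\<Prod>k\<in>{..<s} - {i}. [:- r k, 1:])"
  have "degree h \<le> (\<Sum>k\<in>{..<s} - {i}. 1)"
    unfolding h_def by (rule order.trans[OF degree_prod_sum_le]) auto
  then have deg: "degree h \<le> s - 1" using i by simp
  have h: "poly h x = (\<Sum>j<s. coeff h j * x ^ j)" for x
  proof -
    have "poly h x = (\<Sum>j\<le>s - 1. coeff h j * x ^ j)"
      unfolding poly_altdef using deg by (intro sum.mono_neutral_left) (auto simp: coeff_eq_0)
    also have "{..s - 1} = {..<s}" using i by auto
    finally show ?thesis .
  qed
  have root: "poly h (r l) = 0" if "l < s" "l \<noteq> i" for l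
    using that by (auto simp: h_def poly_prod)
  have "(\<Sum>l<s. n l * poly h (r l)) = n i * poly h (r i)"
    using i root by (subst sum.remove[of _ i]) auto
  moreover have "(\<Sum>l<s. n l * poly h (r l)) = (\<Sum>j<s. coeff h j * (\<Sum>l<s. n l * r l ^ j))"
    unfolding h sum_distrib_left by (subst sum.swap) (simp add: mult_ac)
  moreover have "p dvd (\<Sum>j<s. coeff h j * (\<Sum>l<s. n l * r l ^ j))"
    by (intro dvd_sum dvd_mult dvd) simp
  ultimately have "p dvd n i * poly h (r i)" by argo
  moreover have prod_not_dvd: "\<not> p dvd (\<Prod>k\<in>K. r i - r k)"
    if "finite K" "K \<subseteq> {..<s} - {i}" for K
    using that
  proof (induction K rule: finite_induct)
    case empty
    then show ?case using p by (simp add: prime_elem_def)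
  next
    case (insert k K)
    then show ?case using distinct[of i k] i p by (auto simp: prime_elem_dvd_mult_iff)
  qed
  moreover have "\<not> p dvd poly h (r i)"
    using prod_not_dvd[of "{..<s} - {i}"] i by (auto simp: h_def poly_prod)
  ultimately show ?thesis using p by (simp add: prime_elem_dvd_mult_iff)
qed

lemma foldr_lattice_mean_invariant:
  assumes "q \<in> set rs" "degree n < m"
  shows "foldr (lattice_mean s m p) rs f (translate s m p (\<lambda>j. n * (q ^ j mod p)) x)
    = foldr (lattice_mean s m p) rs f x"
  using assms(1)
proof (induction rs arbitrary: x)
  case (Cons r rs)
  show ?case
  proof (cases "q = r")
    case True
    then show ?thesis using lattice_mean_invariant[OF assms(2)] by simp
  next
    case False
    then have "q \<in> set rs" using Cons.prems by simp
    then have "foldr (lattice_mean s m p) rs f (translate s m p (\<lambda>j. n * (q ^ j mod p)) y)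
        = foldr (lattice_mean s m p) rs f y" for y by (rule Cons.IH)
    then show ?thesis unfolding foldr_Cons comp_def by (rule lattice_mean_translate)
  qed
qed simp

text \<open>Any \<open>s\<close> different lattices together reach every dyadic point from every other. A Vandermonde
  argument shows that the combinations of one element from each lattice act differently on \<open>x\<close>; there
  are \<open>(2\<^sup>m)\<^sup>s\<close> of them, as many as dyadic points, so they reach all points.\<close>

lemma lattice_translates_transitive:
  fixes p :: "bit poly"
  assumes p: "irreducible p" "degree p = m" and "m \<ge> 1"
    and rs: "distinct rs" "set rs \<subseteq> {q. degree q < m}" "length rs = s"
    and xy: "x \<in> dyadic_points s m" "y \<in> dyadic_points s m"
  obtains n where "\<And>i. i < s \<Longrightarrow> degree (n i) < m"
    "y = translate s m p (\<lambda>j. \<Sum>i<s. n i * ((rs ! i) ^ j mod p)) x"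
proof -
  define A where "A = {..<s} \<rightarrow>\<^sub>E {n :: bit poly. degree n < m}"
  define F where "F n = translate s m p (\<lambda>j. \<Sum>i<s. n i * ((rs ! i) ^ j mod p)) x" for n
  have p0: "p \<noteq> 0" using p by auto
  have prime: "prime_elem p" using p(1) by (rule field_poly_irreducible_imp_prime)
  have small: "q = 0" if "p dvd q" "degree q < m" for q
    using that p(2) dvd_imp_degree_le[of p q] by fastforce
  have degree_diff: "degree (a - b) < m" if "degree a < m" "degree b < m" for a b :: "bit poly"
    using that degree_diff_less by blast
  have inj: "inj_on F A"
  proof (rule inj_onI)
    fix n n' assume n: "n \<in> A" "n' \<in> A" and eq: "F n = F n'"
    have deg: "degree (n i) < m" "degree (n' i) < m" if "i < s" for i
      using n that by (auto simp: A_def)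
    have "p dvd n i - n' i" if "i < s" for i
    proof (rule vandermonde_dvd[OF prime _ _ that, where r = "\<lambda>i. rs ! i"])
      fix i k assume "i < s" "k < s" "i \<noteq> k"
      then have "rs ! i - rs ! k \<noteq> 0" using rs by (simp add: nth_eq_iff_index_eq)
      moreover have "degree (rs ! i - rs ! k) < m"
        using rs \<open>i < s\<close> \<open>k < s\<close> by (intro degree_diff) (meson mem_Collect_eq nth_mem subsetD)+
      ultimately show "\<not> p dvd rs ! i - rs ! k" using small by blast
    next
      fix j assume "j < s"
      then have "p dvd (\<Sum>i<s. n i * ((rs ! i) ^ j mod p)) - (\<Sum>i<s. n' i * ((rs ! i) ^ j mod p))"
        using eq p0 p(2) unfolding F_def by (intro dvd_of_translate_eq)
      \<comment> \<open>Undo the reduction of the powers modulo \<open>p\<close>, at the cost of a multiple of \<open>p\<close>.\<close>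
      moreover have "(\<Sum>i<s. (n i - n' i) * (rs ! i) ^ j)
          = (\<Sum>i<s. n i * ((rs ! i) ^ j mod p)) - (\<Sum>i<s. n' i * ((rs ! i) ^ j mod p))
            + p * (\<Sum>i<s. (n i - n' i) * ((rs ! i) ^ j div p))"
      proof -
        have "(n i - n' i) * (rs ! i) ^ j = n i * ((rs ! i) ^ j mod p) - n' i * ((rs ! i) ^ j mod p)
            + p * ((n i - n' i) * ((rs ! i) ^ j div p))" for i
        proof -
          define u v where "u = (rs ! i) ^ j mod p" and "v = (rs ! i) ^ j div p"
          have "(rs ! i) ^ j = p * v + u" by (simp add: u_def v_def)
          then show ?thesis unfolding u_def[symmetric] v_def[symmetric] by (simp add: algebra_simps)
        qed
        then show ?thesis
          unfolding sum_distrib_left sum_subtractf[symmetric] sum.distrib[symmetric]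
          by (intro sum.cong refl)
      qed
      ultimately show "p dvd (\<Sum>i<s. (n i - n' i) * (rs ! i) ^ j)"
        by (simp only:) (intro dvd_add dvd_triv_left)
    qed
    then have "n i - n' i = 0" if "i < s" for i
      using that deg by (intro small degree_diff) auto
    then have "n i = n' i" if "i < s" for i using that by (metis eq_iff_diff_eq_0)
    then show "n = n'"
      using n by (intro PiE_ext[of n "{..<s}" _ n']) (auto simp: A_def)
  qed
  have "card (F ` A) = card A" by (rule card_image[OF inj])
  also have "\<dots> = card (dyadic_points s m)"
    unfolding A_def card_dyadic_points
    by (simp add: card_PiE card_polys_degree_less[OF \<open>m \<ge> 1\<close>])
  finally have "card (F ` A) = card (dyadic_points s m)" .
  moreover have "F ` A \<subseteq> dyadic_points s m" by (auto simp: F_def translate_mem)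
  ultimately have "F ` A = dyadic_points s m" by (intro card_subset_eq finite_dyadic_points)
  then obtain n where "n \<in> A" "y = F n" using xy(2) by blast
  then show thesis by (intro that[of n]) (auto simp: A_def F_def)
qed

text \<open>The iterated mean is invariant under each of the \<open>s\<close> lattices, because the means commute with
  translations. By transitivity it is constant on the dyadic points, and averaging has not changed
  its sum, which is 0.\<close>

lemma foldr_lattice_mean_eq_0:
  fixes p :: "bit poly"
  assumes p: "irreducible p" "degree p = m" and m: "m \<ge> 1"
    and rs: "distinct rs" "set rs \<subseteq> {q. degree q < m}" "length rs = s"
    and f: "(\<Sum>x\<in>dyadic_points s m. f x) = 0" and x: "x \<in> dyadic_points s m"
  shows "foldr (lattice_mean s m p) rs f x = 0"
proof -
  define g where "g = foldr (lattice_mean s m p) rs f"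
  have "(\<Sum>y\<in>dyadic_points s m. foldr (lattice_mean s m p) ss f y) = 0" for ss
    by (induction ss) (simp_all add: f sum_lattice_mean[OF m])
  then have sum0: "(\<Sum>y\<in>dyadic_points s m. g y) = 0" by (simp only: g_def)
  have "g y = g x" if "y \<in> dyadic_points s m" for y
  proof -
    obtain n where n: "\<And>i. i < s \<Longrightarrow> degree (n i) < m"
      "y = translate s m p (\<lambda>j. \<Sum>i<s. n i * ((rs ! i) ^ j mod p)) x"
      using lattice_translates_transitive[OF p m rs x \<open>y \<in> dyadic_points s m\<close>] by blast
    have "g (translate s m p (\<lambda>j. \<Sum>i<k. n i * ((rs ! i) ^ j mod p)) x) = g x" if "k \<le> s" for k
      using that
    proof (induction k)
      case 0
      then show ?case by (simp only: lessThan_0 sum.empty translate_zero[OF x])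
    next
      case (Suc k)
      have "translate s m p (\<lambda>j. \<Sum>i<Suc k. n i * ((rs ! i) ^ j mod p)) x
          = translate s m p (\<lambda>j. n k * ((rs ! k) ^ j mod p))
              (translate s m p (\<lambda>j. \<Sum>i<k. n i * ((rs ! i) ^ j mod p)) x)"
        by (simp only: translate_translate sum.lessThan_Suc add.commute)
      then show ?case
        using Suc rs n(1)[of k] foldr_lattice_mean_invariant[of "rs ! k" rs "n k" m s p f]
        by (simp add: g_def)
    qed
    then show ?thesis using n(2) by simp
  qed
  then have "real (card (dyadic_points s m)) * g x = 0" using sum0 by simp
  then show ?thesis by (simp add: card_dyadic_points g_def)
qed

text \<open>In terms of a uniformly distributed dyadic point: the variances of all \<open>2\<^sup>m\<close> lattice means
  together are at most \<open>s - 1\<close> times the variance of \<open>f\<close>.\<close>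

lemma sum_lattice_mean_squares_le:
  fixes p :: "bit poly"
  assumes "irreducible p" "degree p = m" "m \<ge> 1" "s \<ge> 1"
    and "(\<Sum>x\<in>dyadic_points s m. f x) = 0"
  shows "(\<Sum>q | degree q < m. \<Sum>x\<in>dyadic_points s m. (lattice_mean s m p q f x)\<^sup>2)
    \<le> real (s - 1) * (\<Sum>x\<in>dyadic_points s m. (f x)\<^sup>2)"
proof (rule commuting_projections_sum_le[where N = "\<lambda>f. \<Sum>x\<in>dyadic_points s m. (f x)\<^sup>2"])
  fix rs :: "bit poly list"
  assume "distinct rs" "set rs \<subseteq> {q. degree q < m}" "length rs = s"
  then have "foldr (lattice_mean s m p) rs f x = 0" if "x \<in> dyadic_points s m" for x
    using that assms by (intro foldr_lattice_mean_eq_0)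
  then show "(\<Sum>x\<in>dyadic_points s m. (foldr (lattice_mean s m p) rs f x)\<^sup>2) = 0" by simp
qed (rule finite_polys_degree_less lattice_mean_pythagoras lattice_mean_commute lattice_mean_diff
  sum_nonneg zero_le_power2 assms)+

section \<open>Exponential tail bounds\<close>

text \<open>For negative \<open>x = -y\<close> this follows from \<open>exp y \<ge> 1 + y + y\<^sup>2/2\<close>, since the product of that
  lower bound with \<open>1 - y + y\<^sup>2\<close> is at least 1.\<close>

lemma exp_le_quadratic:
  fixes x :: real
  assumes "\<bar>x\<bar> \<le> 1"
  shows "exp x \<le> 1 + x + x\<^sup>2"
proof (cases "x \<ge> 0")
  case True
  then show ?thesis using exp_bound[of x] assms by simp
next
  case False
  define y where "y = - x"
  have y: "0 \<le> y" using False by (simp add: y_def)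
  have "exp x = 1 / exp y" by (simp add: y_def exp_minus field_simps)
  also have "\<dots> \<le> 1 / (1 + y + y\<^sup>2 / 2)"
    using exp_lower_Taylor_quadratic[OF y] y
    by (intro divide_left_mono mult_pos_pos) (auto intro!: add_pos_nonneg)
  also have "\<dots> \<le> 1 - y + y\<^sup>2"
  proof -
    have "(1 - y + y\<^sup>2) * (1 + y + y\<^sup>2 / 2) = 1 + y\<^sup>2 / 2 + y ^ 3 / 2 + y ^ 4 / 2"
      by (simp add: field_simps power2_eq_square power3_eq_cube power4_eq_xxxx)
    also have "\<dots> \<ge> 1" using y by (simp add: add_nonneg_nonneg)
    finally show ?thesis
      using y by (subst pos_divide_le_eq) (auto intro!: add_pos_nonneg)
  qed
  finally show ?thesis by (simp add: y_def)
qed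

context prob_space
begin

text \<open>Chernoff's method with exponent 1: by \<open>exp y \<le> 1 + y + y\<^sup>2\<close> each factor of the moment generating
  function is at most the exponential of a variance.\<close>

lemma sum_indep_upper_tail:
  fixes Y :: "'i \<Rightarrow> 'a \<Rightarrow> real"
  assumes I: "finite I" and indep: "indep_vars (\<lambda>_. borel) Y I"
    and bound: "\<And>i \<omega>. i \<in> I \<Longrightarrow> \<omega> \<in> space M \<Longrightarrow> \<bar>Y i \<omega>\<bar> \<le> 1"
    and mean: "\<And>i. i \<in> I \<Longrightarrow> expectation (Y i) = 0"
    and var: "(\<Sum>i\<in>I. expectation (\<lambda>\<omega>. (Y i \<omega>)\<^sup>2)) \<le> v"
  shows "prob {\<omega> \<in> space M. (\<Sum>i\<in>I. Y i \<omega>) \<ge> t} \<le> exp (v - t)"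
proof -
  have meas [measurable]: "Y i \<in> borel_measurable M" if "i \<in> I" for i
    using indep that by (auto simp: indep_vars_def)
  have int1: "integrable M (Y i)" if "i \<in> I" for i
    using that bound by (intro integrable_const_bound[where B = 1]) (auto intro!: AE_I2)
  have int2: "integrable M (\<lambda>\<omega>. (Y i \<omega>)\<^sup>2)" if "i \<in> I" for i
    using that bound
    by (intro integrable_const_bound[where B = 1]) (auto intro!: AE_I2 simp: abs_square_le_1)
  have int_exp: "integrable M (\<lambda>\<omega>. exp (Y i \<omega>))" if "i \<in> I" for i
    using that bound
    by (intro integrable_const_bound[where B = "exp 1"]) (auto intro!: AE_I2 dest: abs_le_D1)
  have indep_exp: "indep_vars (\<lambda>_. borel) (\<lambda>i \<omega>. exp (Y i \<omega>)) I"
    by (rule indep_vars_compose2[OF indep]) simp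
  have "prob {\<omega> \<in> space M. (\<Sum>i\<in>I. Y i \<omega>) \<ge> t} = prob {\<omega> \<in> space M. (\<Prod>i\<in>I. exp (Y i \<omega>)) \<ge> exp t}"
    by (simp add: exp_sum[OF I, symmetric])
  also have "\<dots> \<le> expectation (\<lambda>\<omega>. \<Prod>i\<in>I. exp (Y i \<omega>)) / exp t"
    using indep_vars_integrable[OF I indep_exp int_exp]
    by (intro integral_Markov_inequality_measure[where A = "{}"]) (auto intro!: AE_I2 prod_nonneg)
  also have "expectation (\<lambda>\<omega>. \<Prod>i\<in>I. exp (Y i \<omega>)) = (\<Prod>i\<in>I. expectation (\<lambda>\<omega>. exp (Y i \<omega>)))"
    by (rule indep_vars_lebesgue_integral[OF I indep_exp int_exp])
  also have "\<dots> \<le> (\<Prod>i\<in>I. exp (expectation (\<lambda>\<omega>. (Y i \<omega>)\<^sup>2)))"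
  proof (rule prod_mono)
    fix i assume i: "i \<in> I"
    have "expectation (\<lambda>\<omega>. exp (Y i \<omega>)) \<le> expectation (\<lambda>\<omega>. 1 + Y i \<omega> + (Y i \<omega>)\<^sup>2)"
      using i int1 int2 int_exp bound by (intro integral_mono) (auto intro: exp_le_quadratic)
    also have "\<dots> = 1 + expectation (\<lambda>\<omega>. (Y i \<omega>)\<^sup>2)"
      using i int1 int2 mean by (simp add: prob_space)
    also have "\<dots> \<le> exp (expectation (\<lambda>\<omega>. (Y i \<omega>)\<^sup>2))" by (rule exp_ge_add_one_self)
    finally show "0 \<le> expectation (\<lambda>\<omega>. exp (Y i \<omega>)) \<and>
        expectation (\<lambda>\<omega>. exp (Y i \<omega>)) \<le> exp (expectation (\<lambda>\<omega>. (Y i \<omega>)\<^sup>2))"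
      by (simp add: integral_nonneg_AE)
  qed
  also have "\<dots> \<le> exp v" using var by (simp add: exp_sum[OF I, symmetric])
  finally show ?thesis by (simp add: exp_diff divide_right_mono)
qed

lemma sum_indep_two_sided_tail:
  fixes Y :: "'i \<Rightarrow> 'a \<Rightarrow> real"
  assumes I: "finite I" and indep: "indep_vars (\<lambda>_. borel) Y I"
    and bound: "\<And>i \<omega>. i \<in> I \<Longrightarrow> \<omega> \<in> space M \<Longrightarrow> \<bar>Y i \<omega>\<bar> \<le> 1"
    and mean: "\<And>i. i \<in> I \<Longrightarrow> expectation (Y i) = 0"
    and var: "(\<Sum>i\<in>I. expectation (\<lambda>\<omega>. (Y i \<omega>)\<^sup>2)) \<le> v"
  shows "prob {\<omega> \<in> space M. \<bar>\<Sum>i\<in>I. Y i \<omega>\<bar> \<ge> t} \<le> 2 * exp (v - t)"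
proof -
  have meas [measurable]: "Y i \<in> borel_measurable M" if "i \<in> I" for i
    using indep that by (auto simp: indep_vars_def)
  have neg: "indep_vars (\<lambda>_. borel) (\<lambda>i \<omega>. - Y i \<omega>) I"
    by (rule indep_vars_compose2[OF indep]) simp
  have "{\<omega> \<in> space M. \<bar>\<Sum>i\<in>I. Y i \<omega>\<bar> \<ge> t}
      = {\<omega> \<in> space M. (\<Sum>i\<in>I. Y i \<omega>) \<ge> t} \<union> {\<omega> \<in> space M. (\<Sum>i\<in>I. - Y i \<omega>) \<ge> t}"
    by (auto simp: sum_negf abs_if split: if_splits)
  also have "prob \<dots> \<le> prob {\<omega> \<in> space M. (\<Sum>i\<in>I. Y i \<omega>) \<ge> t}
      + prob {\<omega> \<in> space M. (\<Sum>i\<in>I. - Y i \<omega>) \<ge> t}"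
    by (intro measure_Un_le) measurable
  also have "\<dots> \<le> exp (v - t) + exp (v - t)"
    by (intro add_mono sum_indep_upper_tail I indep neg) (use bound mean var in auto)
  finally show ?thesis by simp
qed

end

section \<open>Discrepancy of the shifted union\<close>

lemma sum_nat_poly:
  assumes "m \<ge> 1"
  shows "(\<Sum>r<2 ^ m. h (nat_poly m r)) = (\<Sum>q | degree q < m. h q)"
  by (rule sum.reindex_bij_betw[OF bij_betw_nat_poly[OF assms]])

text \<open>The digits of a lattice point are Laurent digits, so shifting the lattice by \<open>\<tau>\<close> amounts to
  translating \<open>\<tau>\<close> by the lattice elements.\<close>

lemma sum_mset_digital_shift_korobov:
  "(\<Sum>x\<in>#digital_shift s m (korobov_point_set s m p q) \<tau>. h x)
    = (\<Sum>n<2 ^ m. h (translate s m p (\<lambda>j. nat_poly m n * (q ^ j mod p)) \<tau>))"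
proof -
  have eq: "(\<lambda>j\<in>{..<s}. digital_add m (korobov_point s m p q n j) (\<tau> j))
      = translate s m p (\<lambda>j. nat_poly m n * (q ^ j mod p)) \<tau>" for n
    unfolding translate_def
  proof (rule restrict_ext)
    fix j assume "j \<in> {..<s}"
    then have "korobov_point s m p q n j
        = of_digits m (laurent_digit p (nat_poly m n * (q ^ j mod p)))"
      by (simp add: korobov_point_def nu_def of_digits_def laurent_digit_def)
    then show "digital_add m (korobov_point s m p q n j) (\<tau> j)
        = of_digits m (\<lambda>i. bin_digit (\<tau> j) i + laurent_digit p (nat_poly m n * (q ^ j mod p)) i)"
      unfolding digital_add_def of_digits_def[symmetric]
      by (intro of_digits_cong) (simp only: bin_digit_of_digits add.commute)
  qed
  show ?thesis
    unfolding digital_shift_def korobov_point_set_def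
    by (simp add: multiset.map_comp comp_def eq sum_unfold_sum_mset)
qed

lemma sum_mset_shifted_korobov_union:
  fixes h :: "(nat \<Rightarrow> real) \<Rightarrow> 'b::comm_monoid_add"
  shows "(\<Sum>x\<in>#shifted_korobov_union s m p \<sigma>. h x)
    = (\<Sum>r<2 ^ m. \<Sum>n<2 ^ m.
        h (translate s m p (\<lambda>j. nat_poly m n * (nat_poly m r ^ j mod p)) (\<sigma> (Suc r))))"
proof -
  have "(\<Sum>x\<in>#(\<Sum>r\<in>R. F r). h x) = (\<Sum>r\<in>R. \<Sum>x\<in>#F r. h x)"
    if "finite R" for R :: "nat set" and F
    using that by (induction R rule: finite_induct) simp_all
  then show ?thesis
    unfolding shifted_korobov_union_def by (simp add: sum_mset_digital_shift_korobov)
qed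

lemma size_shifted_korobov_union: "size (shifted_korobov_union s m p \<sigma>) = 2 ^ (2 * m)"
proof -
  have "size (shifted_korobov_union s m p \<sigma>) = (\<Sum>x\<in>#shifted_korobov_union s m p \<sigma>. 1)"
    by (rule size_eq_sum_mset)
  also have "\<dots> = 2 ^ m * 2 ^ m" unfolding sum_mset_shifted_korobov_union by simp
  finally show ?thesis by (simp add: power_add[symmetric] mult_2)
qed

lemma sum_mset_shifted_korobov_union_lattice_mean:
  assumes "m \<ge> 1"
  shows "(\<Sum>x\<in>#shifted_korobov_union s m p \<sigma>. h x)
    = 2 ^ m * (\<Sum>r<2 ^ m. lattice_mean s m p (nat_poly m r) h (\<sigma> (Suc r)))"
proof -
  have "(\<Sum>n<2 ^ m. h (translate s m p (\<lambda>j. nat_poly m n * (q ^ j mod p)) x))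
      = 2 ^ m * lattice_mean s m p q h x" for q x
    using sum.reindex_bij_betw[OF bij_betw_nat_poly[OF assms],
        of "\<lambda>n. h (translate s m p (\<lambda>j. n * (q ^ j mod p)) x)"]
    by (simp add: lattice_mean_def)
  then show ?thesis
    unfolding sum_mset_shifted_korobov_union sum_distrib_left by (simp only:)
qed

lemma measure_anchored_box:
  assumes "\<And>j. j < s \<Longrightarrow> 0 \<le> z j"
  shows "measure (\<Pi>\<^sub>M j\<in>{..<s}. lborel) (anchored_box s z) = (\<Prod>j<s. z j)"
proof -
  interpret product_sigma_finite "\<lambda>_::nat. lborel :: real measure"
    by standard
  have "emeasure (\<Pi>\<^sub>M j\<in>{..<s}. lborel) (anchored_box s z) = (\<Prod>j<s. ennreal (z j))"
    unfolding anchored_box_def using assms by (subst emeasure_PiM) auto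
  also have "\<dots> = ennreal (\<Prod>j<s. z j)" using assms by (intro prod_ennreal) auto
  finally have "emeasure (\<Pi>\<^sub>M j\<in>{..<s}. lborel) (anchored_box s z) = ennreal (\<Prod>j<s. z j)" .
  moreover have "0 \<le> (\<Prod>j<s. z j)" using assms by (intro prod_nonneg) auto
  ultimately show ?thesis by (simp add: measure_def)
qed

definition centered_indicator :: "nat \<Rightarrow> (nat \<Rightarrow> real) \<Rightarrow> (nat \<Rightarrow> real) \<Rightarrow> real" where
  "centered_indicator s z x = indicator (anchored_box s z) x - (\<Prod>j<s. z j)"

text \<open>Corners with coordinates in \<open>{0, 1/2\<^sup>m, \<dots>, 1}\<close>. Both endpoints are needed: rounding up fixes 0 and may
  produce 1.\<close>

definition corner_grid :: "nat \<Rightarrow> nat \<Rightarrow> (nat \<Rightarrow> real) set" where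
  "corner_grid s m = {..<s} \<rightarrow>\<^sub>E (\<lambda>k. real k / 2 ^ m) ` {..2 ^ m}"

lemma finite_corner_grid: "finite (corner_grid s m)"
  unfolding corner_grid_def by (intro finite_PiE) auto

lemma card_corner_grid: "card (corner_grid s m) = (2 ^ m + 1) ^ s"
  by (simp add: corner_grid_def card_PiE card_image inj_on_fraction)

lemma corner_grid_coordinate:
  assumes "z \<in> corner_grid s m" "j < s"
  obtains k where "k \<le> 2 ^ m" "z j = real k / 2 ^ m"
proof -
  have "z j \<in> (\<lambda>k. real k / 2 ^ m) ` {..2 ^ m}"
    using assms PiE_mem[of z "{..<s}" _ j] by (simp add: corner_grid_def)
  then show thesis using that by blast
qed

lemma corner_grid_unit:
  assumes "z \<in> corner_grid s m" "j < s"
  shows "0 \<le> z j" "z j \<le> 1"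
proof -
  obtain k where k: "k \<le> 2 ^ m" "z j = real k / 2 ^ m" using corner_grid_coordinate[OF assms] .
  have "real k \<le> 2 ^ m" using k(1) by (metis of_nat_le_iff of_nat_numeral of_nat_power)
  then show "0 \<le> z j" "z j \<le> 1" by (simp_all add: k(2))
qed

lemma abs_centered_indicator_le_1:
  assumes "z \<in> corner_grid s m"
  shows "\<bar>centered_indicator s z x\<bar> \<le> 1"
proof -
  have "0 \<le> (\<Prod>j<s. z j)" "(\<Prod>j<s. z j) \<le> 1"
    using corner_grid_unit[OF assms] by (auto intro: prod_nonneg prod_le_1)
  then show ?thesis by (auto simp: centered_indicator_def indicator_def)
qed

text \<open>A box with corner on the grid contains exactly its volume's share of the dyadic points.\<close>

lemma sum_centered_indicator:
  assumes z: "z \<in> corner_grid s m"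
  shows "(\<Sum>x\<in>dyadic_points s m. centered_indicator s z x) = 0"
proof -
  have card: "real (card (dyadics m \<inter> {0..<z j})) = 2 ^ m * z j" if j: "j < s" for j
  proof -
    obtain k where k: "k \<le> 2 ^ m" "z j = real k / 2 ^ m" using corner_grid_coordinate[OF z j] .
    have "dyadics m \<inter> {0..<z j} = (\<lambda>k. real k / 2 ^ m) ` {..<k}"
    proof (intro equalityI subsetI)
      fix y assume "y \<in> dyadics m \<inter> {0..<z j}"
      then obtain l where "y = real l / 2 ^ m" "real l / 2 ^ m < real k / 2 ^ m"
        by (auto simp: dyadics_def k(2))
      then show "y \<in> (\<lambda>k. real k / 2 ^ m) ` {..<k}" by (auto simp: divide_less_cancel)
    next
      fix y assume "y \<in> (\<lambda>k. real k / 2 ^ m) ` {..<k}"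
      then obtain l where "l < k" "y = real l / 2 ^ m" by blast
      then show "y \<in> dyadics m \<inter> {0..<z j}"
        using k(1) by (simp add: dyadics_def k(2) divide_less_cancel)
    qed
    then show ?thesis by (simp add: card_image inj_on_fraction k(2))
  qed
  have "dyadic_points s m \<inter> anchored_box s z = (\<Pi>\<^sub>E j\<in>{..<s}. dyadics m \<inter> {0..<z j})"
    by (simp add: dyadic_points_def anchored_box_def PiE_Int)
  then have "real (card (dyadic_points s m \<inter> anchored_box s z)) = (\<Prod>j<s. 2 ^ m * z j)"
    by (simp add: card_PiE card)
  moreover have "(\<Sum>x\<in>dyadic_points s m. indicator (anchored_box s z) x :: real)
      = (\<Sum>x\<in>dyadic_points s m \<inter> anchored_box s z. 1)"
    by (rule sum.mono_neutral_cong_right) (auto simp: finite_dyadic_points)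
  moreover have "(\<Prod>j<s. 2 ^ m * z j) = real (card (dyadic_points s m)) * (\<Prod>j<s. z j)"
    by (simp add: prod.distrib card_dyadic_points)
  ultimately show ?thesis
    unfolding centered_indicator_def sum_subtractf sum_constant by simp
qed

definition round_up :: "nat \<Rightarrow> nat \<Rightarrow> (nat \<Rightarrow> real) \<Rightarrow> nat \<Rightarrow> real" where
  "round_up s m z = (\<lambda>j\<in>{..<s}. real_of_int \<lceil>2 ^ m * z j\<rceil> / 2 ^ m)"

lemma round_up_in_corner_grid:
  assumes "z \<in> {..<s} \<rightarrow>\<^sub>E {0..1}"
  shows "round_up s m z \<in> corner_grid s m"
  unfolding corner_grid_def
proof (rule PiE_I)
  fix j assume j: "j \<in> {..<s}"
  define y where "y = 2 ^ m * z j"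
  have "z j \<in> {0..1}" using assms j by (rule PiE_mem)
  then have y: "0 \<le> y" "y \<le> real_of_int (2 ^ m)" by (simp_all add: y_def)
  define k where "k = nat \<lceil>y\<rceil>"
  have "0 \<le> \<lceil>y\<rceil>" using ceiling_mono[OF y(1)] by (simp only: ceiling_zero)
  then have k: "int k = \<lceil>y\<rceil>" unfolding k_def by (rule nat_0_le)
  have "\<lceil>y\<rceil> \<le> int (2 ^ m)" using ceiling_le[OF y(2)] by simp
  then have "k \<le> 2 ^ m" unfolding k_def nat_le_iff .
  moreover have "round_up s m z j = real k / 2 ^ m"
    using j by (simp only: round_up_def restrict_apply if_True y_def[symmetric] k[symmetric] of_int_of_nat_eq)
  ultimately show "round_up s m z j \<in> (\<lambda>k. real k / 2 ^ m) ` {..2 ^ m}"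
    by (intro image_eqI[of _ _ k]) simp_all
qed (simp add: round_up_def)

text \<open>A multiple of \<open>2\<^sup>-\<^sup>m\<close> lies below \<open>z\<close> iff it lies below \<open>z\<close> rounded up, as boxes are half-open.\<close>

lemma dyadic_point_in_box_round_up:
  assumes x: "x \<in> dyadic_points s m"
  shows "x \<in> anchored_box s (round_up s m z) \<longleftrightarrow> x \<in> anchored_box s z"
proof -
  have "x j < round_up s m z j \<longleftrightarrow> x j < z j" if j: "j < s" for j
  proof -
    have "x j \<in> dyadics m" using x j by (auto simp: dyadic_points_def)
    then obtain k where k: "x j = real k / 2 ^ m" by (auto simp: dyadics_def)
    have "x j < z j \<longleftrightarrow> real_of_int (int k) < 2 ^ m * z j"
      by (simp add: k pos_divide_less_eq mult.commute)
    also have "\<dots> \<longleftrightarrow> int k < \<lceil>2 ^ m * z j\<rceil>" by (rule less_ceiling_iff[symmetric])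
    also have "\<dots> \<longleftrightarrow> real_of_int (int k) < real_of_int \<lceil>2 ^ m * z j\<rceil>"
      by (rule of_int_less_iff[symmetric])
    also have "\<dots> \<longleftrightarrow> x j < round_up s m z j"
      by (simp add: k round_up_def j divide_less_cancel)
    finally show ?thesis by simp
  qed
  then show ?thesis
    unfolding anchored_box_def PiE_iff by (intro conj_cong ball_cong refl) simp
qed

lemma prod_round_up_close:
  assumes z: "z \<in> {..<s} \<rightarrow>\<^sub>E {0..1}"
  shows "\<bar>(\<Prod>j<s. round_up s m z j) - (\<Prod>j<s. z j)\<bar> \<le> real s / 2 ^ m"
proof -
  have close: "norm (round_up s m z j - z j) \<le> 1 / 2 ^ m" if j: "j \<in> {..<s}" for j
  proof -
    define y where "y = 2 ^ m * z j"
    have z: "z j = y / 2 ^ m" by (simp add: y_def)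
    have "round_up s m z j = real_of_int \<lceil>y\<rceil> / 2 ^ m"
      unfolding round_up_def y_def restrict_apply using j by (simp only: if_True)
    then have "norm (round_up s m z j - z j) = \<bar>real_of_int \<lceil>y\<rceil> - y\<bar> / 2 ^ m"
      unfolding z by (simp only: diff_divide_distrib[symmetric] real_norm_def abs_divide) simp
    moreover have gap: "\<bar>c - y\<bar> \<le> 1" if "y \<le> c" "c \<le> y + 1" for c
      using that by linarith
    have "\<bar>real_of_int \<lceil>y\<rceil> - y\<bar> \<le> 1"
      by (rule gap[OF le_of_int_ceiling of_int_ceiling_le_add_one])
    then have "\<bar>real_of_int \<lceil>y\<rceil> - y\<bar> / 2 ^ m \<le> 1 / 2 ^ m"
      by (rule divide_right_mono) (rule zero_le_power[OF zero_le_numeral])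
    ultimately show ?thesis by (simp only:)
  qed
  have "(\<Sum>j<s. norm (round_up s m z j - z j)) \<le> (\<Sum>j<s. 1 / 2 ^ m)"
    by (rule sum_mono) (rule close)
  moreover have "norm ((\<Prod>j<s. round_up s m z j) - (\<Prod>j<s. z j))
      \<le> (\<Sum>j<s. norm (round_up s m z j - z j))"
  proof (rule norm_prod_diff)
    fix j assume j: "j \<in> {..<s}"
    show "norm (round_up s m z j) \<le> 1"
      using corner_grid_unit[OF round_up_in_corner_grid[OF z], of j m] j by simp
    have "z j \<in> {0..1}" using z j by (rule PiE_mem)
    then show "norm (z j) \<le> 1" by simp
  qed
  ultimately show ?thesis by simp
qed

text \<open>The fraction of points in the box splits into the volume of the rounded box and the deviation from
  it, the latter as a sum of one term for each independent shift.\<close>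

lemma box_average_eq:
  assumes m: "m \<ge> 1"
  shows "(\<Sum>x\<in>#shifted_korobov_union s m p \<sigma>. indicator (anchored_box s z) x)
        / real (size (shifted_korobov_union s m p \<sigma>))
      = (\<Sum>r<2 ^ m. lattice_mean s m p (nat_poly m r) (centered_indicator s (round_up s m z)) (\<sigma> (Suc r)))
        / 2 ^ m + (\<Prod>j<s. round_up s m z j)"
proof -
  define w where "w = round_up s m z"
  define S where
    "S = (\<Sum>r<2 ^ m. lattice_mean s m p (nat_poly m r) (centered_indicator s w) (\<sigma> (Suc r)))"
  have mean: "lattice_mean s m p q (indicator (anchored_box s z)) y
      = lattice_mean s m p q (centered_indicator s w) y + (\<Prod>j<s. w j)" for q y
  proof -
    have "lattice_mean s m p q (indicator (anchored_box s z)) = lattice_mean s m p q (indicator (anchored_box s w) :: _ \<Rightarrow> real)"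
      by (rule lattice_mean_cong) (simp add: indicator_def w_def dyadic_point_in_box_round_up)
    moreover have "centered_indicator s w = indicator (anchored_box s w) - (\<lambda>_. \<Prod>j<s. w j)"
      by (rule ext) (simp add: centered_indicator_def)
    then have "lattice_mean s m p q (centered_indicator s w) y
        = lattice_mean s m p q (indicator (anchored_box s w)) y - (\<Prod>j<s. w j)"
      by (simp only: lattice_mean_diff lattice_mean_const[OF m] minus_apply)
    ultimately show ?thesis by simp
  qed
  have "(\<Sum>x\<in>#shifted_korobov_union s m p \<sigma>. indicator (anchored_box s z) x)
      = 2 ^ m * (S + 2 ^ m * (\<Prod>j<s. w j))"
    unfolding sum_mset_shifted_korobov_union_lattice_mean[OF m] mean S_def
    by (simp add: sum.distrib)
  moreover have "real (size (shifted_korobov_union s m p \<sigma>)) = 2 ^ m * 2 ^ m"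
    by (simp add: size_shifted_korobov_union mult_2 power_add)
  moreover have frac: "N * (S + N * P) / (N * N) = S / N + P" if "N \<noteq> 0" for N P :: real
    using that by (simp add: add_divide_distrib)
  have "2 ^ m * (S + 2 ^ m * (\<Prod>j<s. w j)) / (2 ^ m * 2 ^ m) = S / 2 ^ m + (\<Prod>j<s. w j)"
    by (rule frac) simp
  ultimately show ?thesis
    unfolding w_def[symmetric] S_def[symmetric] by (simp only:)
qed

lemma star_discrepancy_shifted_korobov_le:
  assumes m: "m \<ge> 1"
    and \<tau>: "\<And>z. z \<in> corner_grid s m \<Longrightarrow>
      \<bar>\<Sum>r<2 ^ m. lattice_mean s m p (nat_poly m r) (centered_indicator s z) (\<sigma> (Suc r))\<bar> \<le> \<tau>"
  shows "star_discrepancy s (shifted_korobov_union s m p \<sigma>) \<le> (\<tau> + real s) / 2 ^ m"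
  unfolding star_discrepancy_def
proof (rule cSUP_least)
  show "{..<s} \<rightarrow>\<^sub>E {0..1::real} \<noteq> {}" unfolding PiE_eq_empty_iff by simp
next
  fix z :: "nat \<Rightarrow> real" assume z: "z \<in> {..<s} \<rightarrow>\<^sub>E {0..1}"
  let ?S = "\<Sum>r<2 ^ m. lattice_mean s m p (nat_poly m r)
    (centered_indicator s (round_up s m z)) (\<sigma> (Suc r))"
  have vol: "measure (\<Pi>\<^sub>M j\<in>{..<s}. lborel) (anchored_box s z) = (\<Prod>j<s. z j)"
  proof (rule measure_anchored_box)
    fix j assume "j < s"
    then have "z j \<in> {0..1}" by (intro PiE_mem[OF z]) simp
    then show "0 \<le> z j" by simp
  qed
  have "\<bar>?S\<bar> / 2 ^ m \<le> \<tau> / 2 ^ m"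
    by (rule divide_right_mono[OF \<tau>[OF round_up_in_corner_grid[OF z]]]) simp
  then have "\<bar>?S / 2 ^ m\<bar> \<le> \<tau> / 2 ^ m" by (simp only: abs_divide power_abs abs_numeral)
  \<comment> \<open>Stated for variables so that linear arithmetic does not have to look into the sums.\<close>
  moreover have triangle: "\<bar>a + w - v\<bar> \<le> t + u" if "\<bar>a\<bar> \<le> t" "\<bar>w - v\<bar> \<le> u" for a w v t u :: real
    using that by linarith
  ultimately show "\<bar>(\<Sum>x\<in>#shifted_korobov_union s m p \<sigma>. indicator (anchored_box s z) x)
        / real (size (shifted_korobov_union s m p \<sigma>))
      - measure (\<Pi>\<^sub>M j\<in>{..<s}. lborel) (anchored_box s z)\<bar> \<le> (\<tau> + real s) / 2 ^ m"
    unfolding box_average_eq[OF m] vol add_divide_distrib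
    by (intro triangle prod_round_up_close[OF z])
qed

section \<open>Deviation in a single box\<close>

text \<open>The event is a finite union over the possible joint values \<open>t\<close>. It makes events about the discrepancy
  measurable, since the latter is a function of finitely many discrete shifts.\<close>

lemma (in prob_space) sets_finitely_many_discrete:
  assumes "finite I" "finite S" and X: "\<And>i. i \<in> I \<Longrightarrow> X i \<in> measurable M (count_space S)"
  shows "{\<omega> \<in> space M. Q (\<lambda>i\<in>I. X i \<omega>)} \<in> sets M"
proof -
  have "X i \<omega> \<in> S" if "i \<in> I" "\<omega> \<in> space M" for i \<omega>
    using measurable_space[OF X[OF that(1)] that(2)] by simp
  then have "{\<omega> \<in> space M. Q (\<lambda>i\<in>I. X i \<omega>)}
      = (\<Union>t\<in>{t \<in> I \<rightarrow>\<^sub>E S. Q t}. {\<omega> \<in> space M. \<forall>i\<in>I. X i \<omega> = t i})"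
  proof (intro equalityI subsetI)
    fix \<omega> assume "\<omega> \<in> {\<omega> \<in> space M. Q (\<lambda>i\<in>I. X i \<omega>)}"
    then have "\<omega> \<in> space M" "Q (\<lambda>i\<in>I. X i \<omega>)" by simp_all
    moreover have "(\<lambda>i\<in>I. X i \<omega>) \<in> I \<rightarrow>\<^sub>E S"
      using \<open>\<omega> \<in> space M\<close> \<open>\<And>i \<omega>. i \<in> I \<Longrightarrow> \<omega> \<in> space M \<Longrightarrow> X i \<omega> \<in> S\<close>
      by (intro PiE_I) simp_all
    ultimately show "\<omega> \<in> (\<Union>t\<in>{t \<in> I \<rightarrow>\<^sub>E S. Q t}. {\<omega> \<in> space M. \<forall>i\<in>I. X i \<omega> = t i})"
      by (intro UN_I[of "\<lambda>i\<in>I. X i \<omega>"]) simp_all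
  next
    fix \<omega> assume "\<omega> \<in> (\<Union>t\<in>{t \<in> I \<rightarrow>\<^sub>E S. Q t}. {\<omega> \<in> space M. \<forall>i\<in>I. X i \<omega> = t i})"
    then obtain t where t: "t \<in> I \<rightarrow>\<^sub>E S" "Q t" "\<omega> \<in> space M" "\<And>i. i \<in> I \<Longrightarrow> X i \<omega> = t i"
      by blast
    have "(\<lambda>i\<in>I. X i \<omega>) = t"
    proof (rule ext)
      fix i show "(\<lambda>i\<in>I. X i \<omega>) i = t i"
        using t(4)[of i] PiE_arb[OF t(1), of i] by (cases "i \<in> I") simp_all
    qed
    then show "\<omega> \<in> {\<omega> \<in> space M. Q (\<lambda>i\<in>I. X i \<omega>)}" using t by simp
  qed
  also have "\<dots> \<in> sets M"
  proof (rule sets.finite_UN)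
    show "finite {t \<in> I \<rightarrow>\<^sub>E S. Q t}" using assms by (simp add: finite_PiE)
  next
    fix t
    have "{\<omega> \<in> space M. X i \<omega> = t i} \<in> sets M" if "i \<in> I" for i
    proof -
      have "X i -` (S \<inter> {t i}) \<inter> space M \<in> sets M"
        by (rule measurable_sets[OF X[OF that]]) simp
      also have "X i -` (S \<inter> {t i}) \<inter> space M = {\<omega> \<in> space M. X i \<omega> = t i}"
        using measurable_space[OF X[OF that]] by auto
      finally show ?thesis .
    qed
    then show "{\<omega> \<in> space M. \<forall>i\<in>I. X i \<omega> = t i} \<in> sets M"
      by (rule sets.sets_Collect_finite_All[OF _ \<open>finite I\<close>])
  qed
  finally show ?thesis .
qed

text \<open>The lattice means evaluated at the shifts are independent and bounded by 1. As the shifts are uniform, their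
  expectations are the mean of the centred indicator, namely 0, and their second moments are the normalised squared norms of
  its projections, whose sum is at most \<open>s - 1\<close>.\<close>

lemma (in prob_space) corner_sum_tail:
  fixes p :: "bit poly" and \<sigma> :: "nat \<Rightarrow> 'a \<Rightarrow> nat \<Rightarrow> real"
  assumes s: "s \<ge> 1" and m: "m \<ge> 1" and p: "irreducible p" "degree p = m"
    and indep: "indep_vars (\<lambda>_. count_space (dyadic_points s m)) \<sigma> {1..2 ^ m}"
    and unif: "\<And>r. r \<in> {1..2 ^ m} \<Longrightarrow>
      distr M (count_space (dyadic_points s m)) (\<sigma> r) = uniform_count_measure (dyadic_points s m)"
    and z: "z \<in> corner_grid s m"
  shows "prob {\<omega> \<in> space M. t \<le>
      \<bar>\<Sum>r<2 ^ m. lattice_mean s m p (nat_poly m r) (centered_indicator s z) (\<sigma> (Suc r) \<omega>)\<bar>}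
    \<le> 2 * exp (real (s - 1) - t)"
proof -
  define f where "f = centered_indicator s z"
  define g where "g r = lattice_mean s m p (nat_poly m (r - 1)) f" for r
  define \<Omega> where "\<Omega> = dyadic_points s m"
  have fin: "finite \<Omega>" by (simp add: \<Omega>_def finite_dyadic_points)
  have card: "real (card \<Omega>) > 0" by (simp add: \<Omega>_def card_dyadic_points)
  have f1: "\<bar>f x\<bar> \<le> 1" for x unfolding f_def by (rule abs_centered_indicator_le_1[OF z])
  have f0: "(\<Sum>x\<in>\<Omega>. f x) = 0" unfolding f_def \<Omega>_def by (rule sum_centered_indicator[OF z])
  have expect: "expectation (\<lambda>\<omega>. h (\<sigma> r \<omega>)) = (\<Sum>x\<in>\<Omega>. h x) / real (card \<Omega>)"
    if "r \<in> {1..2 ^ m}" for r and h :: "(nat \<Rightarrow> real) \<Rightarrow> real"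
  proof -
    have "\<sigma> r \<in> measurable M (count_space \<Omega>)"
      using indep that unfolding indep_vars_def \<Omega>_def by blast
    then have "expectation (\<lambda>\<omega>. h (\<sigma> r \<omega>)) = (\<integral>x. h x \<partial>distr M (count_space \<Omega>) (\<sigma> r))"
      by (subst integral_distr) simp_all
    then show ?thesis
      unfolding \<Omega>_def unif[OF that] by (simp only: integral_uniform_count_measure[OF fin[unfolded \<Omega>_def]])
  qed
  have "prob {\<omega> \<in> space M. t \<le> \<bar>\<Sum>r\<in>{1..2 ^ m}. g r (\<sigma> r \<omega>)\<bar>} \<le> 2 * exp (real (s - 1) - t)"
  proof (rule sum_indep_two_sided_tail)
    show "indep_vars (\<lambda>_. borel) (\<lambda>r \<omega>. g r (\<sigma> r \<omega>)) {1..2 ^ m}"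
      by (rule indep_vars_compose2[OF indep]) simp
  next
    fix r \<omega> show "\<bar>g r (\<sigma> r \<omega>)\<bar> \<le> 1" unfolding g_def by (rule abs_lattice_mean_le[OF m f1])
  next
    fix r :: nat assume r: "r \<in> {1..2 ^ m}"
    show "expectation (\<lambda>\<omega>. g r (\<sigma> r \<omega>)) = 0"
      unfolding expect[OF r] g_def \<Omega>_def sum_lattice_mean[OF m] using f0 by (simp add: \<Omega>_def)
  next
    have "(\<Sum>r\<in>{1..2 ^ m}. expectation (\<lambda>\<omega>. (g r (\<sigma> r \<omega>))\<^sup>2))
        = (\<Sum>r\<in>{1..2 ^ m}. (\<Sum>x\<in>\<Omega>. (g r x)\<^sup>2) / real (card \<Omega>))"
    proof (rule sum.cong[OF refl])
      fix r :: nat assume "r \<in> {1..2 ^ m}"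
      then show "expectation (\<lambda>\<omega>. (g r (\<sigma> r \<omega>))\<^sup>2) = (\<Sum>x\<in>\<Omega>. (g r x)\<^sup>2) / real (card \<Omega>)"
        by (rule expect[of r "\<lambda>x. (g r x)\<^sup>2"])
    qed
    also have "\<dots> = (\<Sum>r<2 ^ m. (\<Sum>x\<in>\<Omega>. (g (Suc r) x)\<^sup>2) / real (card \<Omega>))"
      unfolding One_nat_def by (rule sum.atLeast1_atMost_eq)
    also have "\<dots> = (\<Sum>q | degree q < m. \<Sum>x\<in>\<Omega>. (lattice_mean s m p q f x)\<^sup>2) / real (card \<Omega>)"
      unfolding sum_nat_poly[OF m, symmetric] sum_divide_distrib[symmetric] by (simp add: g_def)
    also have "\<dots> \<le> (real (s - 1) * (\<Sum>x\<in>\<Omega>. (f x)\<^sup>2)) / real (card \<Omega>)"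
      using sum_lattice_mean_squares_le[OF p m s f0[unfolded \<Omega>_def]]
      by (intro divide_right_mono) (simp_all add: \<Omega>_def)
    also have "\<dots> \<le> (real (s - 1) * real (card \<Omega>)) / real (card \<Omega>)"
    proof -
      have "(\<Sum>x\<in>\<Omega>. (f x)\<^sup>2) \<le> (\<Sum>x\<in>\<Omega>. 1)"
        using f1 by (intro sum_mono) (simp add: abs_square_le_1)
      then show ?thesis by (intro divide_right_mono mult_left_mono) simp_all
    qed
    also have "\<dots> = real (s - 1)" using card by simp
    finally show "(\<Sum>r\<in>{1..2 ^ m}. expectation (\<lambda>\<omega>. (g r (\<sigma> r \<omega>))\<^sup>2)) \<le> real (s - 1)" .
  qed simp
  moreover have "(\<Sum>r\<in>{1..2 ^ m}. g r (\<sigma> r \<omega>))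
      = (\<Sum>r<2 ^ m. lattice_mean s m p (nat_poly m r) f (\<sigma> (Suc r) \<omega>))" for \<omega>
    unfolding One_nat_def sum.atLeast1_atMost_eq g_def by simp
  ultimately show ?thesis by (simp only: f_def)
qed

section \<open>Numerical estimates\<close>

text \<open>Four terms of the area hyperbolic tangent series for \<open>ln 3\<close> are accurate enough for \<open>C\<^sub>0\<close>.\<close>

lemma ln_3_bounds: "1.098 \<le> ln (3::real)" "ln (3::real) \<le> 1.0987"
  using ln_approx_bounds[of 3 4] by (simp_all add: eval_nat_numeral)

lemma C0_bounds: "1.723 \<le> C\<^sub>0" "C\<^sub>0 < 1.724"
proof -
  have "4.169 \<le> sqrt (1 + 18 / ln 3)"
    using ln_3_bounds by (intro real_le_rsqrt) (simp add: power2_eq_square field_simps)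
  then show "1.723 \<le> C\<^sub>0" by (simp add: C\<^sub>0_def)
  have "sqrt (1 + 18 / ln 3) < 4.172"
    using ln_3_bounds by (intro real_less_lsqrt) (simp_all add: power2_eq_square field_simps)
  then show "C\<^sub>0 < 1.724" by (simp add: C\<^sub>0_def)
qed

text \<open>The threshold \<open>\<tau>\<close> is chosen so that, with \<open>(2\<^sup>m + 1)\<^sup>s \<le> 2\<^bsup>(m + 1)s\<^esup>\<close>, the union bound over all corners comes
  to \<open>1 - \<delta>\<close>.\<close>

lemma union_bound_value:
  fixes \<delta> :: real
  assumes "s \<ge> 1" "\<delta> < 1"
    and \<tau>: "\<tau> = ln 2 + real (m + 1) * real s * ln 2 - ln (1 - \<delta>) + real s - 1"
  shows "(2 ^ m + 1) ^ s * (2 * exp (real (s - 1) - \<tau>)) \<le> 1 - \<delta>"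
proof -
  have "real (s - 1) - \<tau> = ln (1 - \<delta>) - ln 2 - real ((m + 1) * s) * ln 2"
    using assms(1) by (simp add: \<tau> of_nat_diff algebra_simps)
  then have "exp (real (s - 1) - \<tau>) = exp (ln (1 - \<delta>)) / exp (ln 2) / exp (real ((m + 1) * s) * ln 2)"
    by (simp only: exp_diff)
  also have "exp (real ((m + 1) * s) * ln 2) = (2::real) ^ ((m + 1) * s)"
    by (simp only: exp_of_nat_mult) simp
  finally have e: "exp (real (s - 1) - \<tau>) = (1 - \<delta>) / 2 / 2 ^ ((m + 1) * s)"
    using assms(2) by simp
  have "(2 ^ m + 1 :: real) ^ s \<le> (2 ^ (m + 1)) ^ s" by (intro power_mono) simp_all
  also have "\<dots> = 2 ^ ((m + 1) * s)" by (simp only: power_mult)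
  finally have "(2 ^ m + 1) ^ s * (2 * exp (real (s - 1) - \<tau>))
      \<le> 2 ^ ((m + 1) * s) * (2 * exp (real (s - 1) - \<tau>))"
    by (intro mult_right_mono) simp_all
  also have "\<dots> = 1 - \<delta>" unfolding e by simp
  finally show ?thesis .
qed

text \<open>Compare coefficients, using \<open>C\<^sub>0 \<ge> 3/2\<close>: up to nonnegative terms the difference of \<open>3/2\<close> times
  the bracket on the right and \<open>\<tau> + s\<close> is \<open>s ((2m + 1/2) ln 2 - 1/2)\<close>, which is nonnegative for
  \<open>m \<ge> 1\<close>.\<close>

lemma discrepancy_bound_value:
  fixes \<delta> :: real
  assumes "s \<ge> 1" "m \<ge> 1" "0 < \<delta>" "\<delta> < 1"
    and \<tau>: "\<tau> = ln 2 + real (m + 1) * real s * ln 2 - ln (1 - \<delta>) + real s - 1"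
  shows "(\<tau> + real s) / 2 ^ m
    \<le> C\<^sub>0 * ((real s * (ln (2 * 2 ^ (2 * m)) + 1) + ln 2 - ln (1 - \<delta>)) / sqrt (2 ^ (2 * m)))"
proof -
  have sqrt: "sqrt (2 ^ (2 * m)) = 2 ^ m" by (simp add: power_even_eq)
  have ln: "ln (2 * 2 ^ (2 * m)) = (2 * real m + 1) * ln (2::real)"
    by (simp add: ln_mult ln_realpow algebra_simps)
  define l where "l = ln (2::real)"
  define b where "b = ln 2 - ln (1 - \<delta>)"
  define B where "B = real s * ((2 * real m + 1) * l + 1) + b"
  have l: "l \<ge> 2 / 3" unfolding l_def using ln2_ge_two_thirds by simp
  have "ln (1 - \<delta>) \<le> 0" using assms by simp
  then have b: "b \<ge> 0" using l by (simp add: b_def l_def[symmetric])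
  have nonneg: "0 \<le> real s * ((2 * real m + 1 / 2) * l - 1 / 2)"
  proof (rule mult_nonneg_nonneg)
    have "1 * (2 / 3) \<le> (2 * real m + 1 / 2) * l" using assms(2) l by (intro mult_mono) simp_all
    then show "0 \<le> (2 * real m + 1 / 2) * l - 1 / 2" by simp
  qed simp
  have "B \<ge> 0" unfolding B_def using l b by (intro add_nonneg_nonneg mult_nonneg_nonneg) simp_all
  have "\<tau> + real s = b + real s * ((real m + 1) * l + 2) - 1"
    by (simp add: \<tau> b_def l_def algebra_simps)
  also have "\<dots> \<le> 3 / 2 * B"
    using nonneg b unfolding B_def by (simp add: algebra_simps)
  also have "\<dots> \<le> C\<^sub>0 * B" using C0_bounds(1) \<open>B \<ge> 0\<close> by (intro mult_right_mono) simp_all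
  finally have "\<tau> + real s \<le> C\<^sub>0 * B" .
  then have "(\<tau> + real s) / 2 ^ m \<le> C\<^sub>0 * B / 2 ^ m" by (rule divide_right_mono) simp
  moreover have "real s * (ln (2 * 2 ^ (2 * m)) + 1) + ln 2 - ln (1 - \<delta>) = B"
    unfolding ln B_def b_def l_def by simp
  ultimately show ?thesis unfolding sqrt by simp
qed

section \<open>The discrepancy bound\<close>

theorem theorem1p3:
  fixes s m :: nat and p :: "bit poly"
    and M :: "'w measure" and \<sigma> :: "nat \<Rightarrow> 'w \<Rightarrow> nat \<Rightarrow> real"
    and \<delta> :: real
  assumes "s \<ge> 1" and "m \<ge> 1"
    and "irreducible p" and "degree p = m"
    and "prob_space M"
    and "prob_space.indep_vars M (\<lambda>_. count_space (dyadic_points s m)) \<sigma> {1..2 ^ m}"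
    and "\<And>r. r \<in> {1..2 ^ m} \<Longrightarrow>
           distr M (count_space (dyadic_points s m)) (\<sigma> r) = uniform_count_measure (dyadic_points s m)"
    and "0 < \<delta>" and "\<delta> < 1"
  shows "(\<forall>\<omega>\<in>space M. size (shifted_korobov_union s m p (\<lambda>r. \<sigma> r \<omega>)) = 2 ^ (2 * m)) \<and>
    measure M {\<omega> \<in> space M.
        star_discrepancy s (shifted_korobov_union s m p (\<lambda>r. \<sigma> r \<omega>))
          \<le> C\<^sub>0 * ((real s * (ln (2 * 2 ^ (2 * m)) + 1) + ln 2 - ln (1 - \<delta>)) / sqrt (2 ^ (2 * m)))}
      \<ge> \<delta> \<and>
    1.723 \<le> C\<^sub>0 \<and> C\<^sub>0 < 1.724"
proof (intro conjI C0_bounds ballI size_shifted_korobov_union)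
  interpret prob_space M by fact
  define \<tau> where "\<tau> = ln 2 + real (m + 1) * real s * ln 2 - ln (1 - \<delta>) + real s - 1"
  define bound where
    "bound = C\<^sub>0 * ((real s * (ln (2 * 2 ^ (2 * m)) + 1) + ln 2 - ln (1 - \<delta>)) / sqrt (2 ^ (2 * m)))"
  define S where "S z \<omega> =
    \<bar>\<Sum>r<2 ^ m. lattice_mean s m p (nat_poly m r) (centered_indicator s z) (\<sigma> (Suc r) \<omega>)\<bar>"
    for z \<omega>
  define bad where "bad z = {\<omega> \<in> space M. \<tau> \<le> S z \<omega>}" for z
  define good where
    "good = {\<omega> \<in> space M. star_discrepancy s (shifted_korobov_union s m p (\<lambda>r. \<sigma> r \<omega>)) \<le> bound}"
  have meas: "\<sigma> r \<in> measurable M (count_space (dyadic_points s m))" if "r \<in> {1..2 ^ m}" for r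
    using assms(6) that unfolding indep_vars_def by blast
  have sets: "{\<omega> \<in> space M. Q (\<lambda>r\<in>{1..2 ^ m}. \<sigma> r \<omega>)} \<in> sets M" for Q
    by (rule sets_finitely_many_discrete[OF _ finite_dyadic_points meas]) simp_all
  have "shifted_korobov_union s m p (\<lambda>r. \<sigma> r \<omega>)
      = shifted_korobov_union s m p (\<lambda>r\<in>{1..2 ^ m}. \<sigma> r \<omega>)" for \<omega>
    unfolding shifted_korobov_union_def by (intro sum.cong refl) (simp add: Suc_leI)
  then have good_sets: "good \<in> sets M"
    unfolding good_def
    using sets[of "\<lambda>t. star_discrepancy s (shifted_korobov_union s m p t) \<le> bound"] by (simp only:)
  have "S z \<omega> = \<bar>\<Sum>r<2 ^ m. lattice_mean s m p (nat_poly m r) (centered_indicator s z)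
      ((\<lambda>r\<in>{1..2 ^ m}. \<sigma> r \<omega>) (Suc r))\<bar>" for z \<omega>
    unfolding S_def by (intro arg_cong[where f = abs] sum.cong refl) (simp add: Suc_leI)
  then have bad_sets: "bad z \<in> sets M" for z
    unfolding bad_def
    using sets[of "\<lambda>t. \<tau> \<le> \<bar>\<Sum>r<2 ^ m. lattice_mean s m p (nat_poly m r) (centered_indicator s z) (t (Suc r))\<bar>"]
    by (simp only:)
  have "prob (\<Union>z\<in>corner_grid s m. bad z) \<le> (\<Sum>z\<in>corner_grid s m. prob (bad z))"
    by (rule finite_measure_subadditive_finite[OF finite_corner_grid]) (use bad_sets in blast)
  also have "\<dots> \<le> (\<Sum>z\<in>corner_grid s m. 2 * exp (real (s - 1) - \<tau>))"
    unfolding bad_def S_def by (intro sum_mono corner_sum_tail assms)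
  also have "\<dots> = (2 ^ m + 1) ^ s * (2 * exp (real (s - 1) - \<tau>))"
    by (simp add: card_corner_grid add.commute)
  also have "\<dots> \<le> 1 - \<delta>" by (rule union_bound_value[OF assms(1,9) \<tau>_def])
  finally have bad_prob: "prob (\<Union>z\<in>corner_grid s m. bad z) \<le> 1 - \<delta>" .
  have "space M - (\<Union>z\<in>corner_grid s m. bad z) \<subseteq> good"
  proof
    fix \<omega> assume \<omega>: "\<omega> \<in> space M - (\<Union>z\<in>corner_grid s m. bad z)"
    have "S z \<omega> \<le> \<tau>" if "z \<in> corner_grid s m" for z
      using \<omega> that unfolding bad_def by force
    then have "star_discrepancy s (shifted_korobov_union s m p (\<lambda>r. \<sigma> r \<omega>)) \<le> (\<tau> + real s) / 2 ^ m"
      unfolding S_def by (rule star_discrepancy_shifted_korobov_le[OF assms(2)])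
    also have "\<dots> \<le> bound"
      unfolding bound_def by (rule discrepancy_bound_value[OF assms(1,2,8,9) \<tau>_def])
    finally show "\<omega> \<in> good" using \<omega> unfolding good_def by blast
  qed
  then have "prob (space M - (\<Union>z\<in>corner_grid s m. bad z)) \<le> prob good"
    using good_sets by (rule finite_measure_mono)
  moreover have "(\<Union>z\<in>corner_grid s m. bad z) \<in> sets M"
    by (rule sets.finite_UN[OF finite_corner_grid bad_sets])
  ultimately show "\<delta> \<le> measure M {\<omega> \<in> space M.
        star_discrepancy s (shifted_korobov_union s m p (\<lambda>r. \<sigma> r \<omega>))
          \<le> C\<^sub>0 * ((real s * (ln (2 * 2 ^ (2 * m)) + 1) + ln 2 - ln (1 - \<delta>)) / sqrt (2 ^ (2 * m)))}"
    using bad_prob prob_compl[of "\<Union>z\<in>corner_grid s m. bad z"]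
    unfolding good_def bound_def by linarith
qed

end
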